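(* Let $T>0$, $a>0$, $N\in\mathbb{Z}$ and let $f:\mathbb{R}\to\mathbb{R}$ be a continuous $T$-periodic function with $\int_0^T f(t)\,dt=0$. Consider the equation $$\frac{d}{dt}\left(\frac{\dot x}{\sqrt{1-\dot x^2}}\right)+a\sin x=f(t).$$ If $0<a<\pi^2/T^2$, then either the number of isolated $T$-periodic solutions with winding number $N$ (counted up to addition of integer multiples of $2\pi$) is finite, or we are in the degenerate case and every degenerate solution is unstable. If $a=\pi^2/T^2$ and $f(t)$ is not the trigonometric function $a\sin\left(\frac{2N\pi}{T}t\right)$, the same result holds true.
   Context: With $q=x$, $p=\dot x/\sqrt{1-\dot x^2}$ the equation is equivalent to the system $\dot q=\frac{p}{\sqrt{1+p^2}}$, $\dot p=-a\sin q+f(t)$, whose solutions are globally defined. A $T$-periodic solution with winding number $N$ is a solution with $x(t+T)=x(t)+2N\pi$ for all $t$, i.e. $q(t+T)=q(t)+2N\pi$, $p(t+T)=p(t)$. Isolated: a $T$-periodic solution with winding number $N$, $(\hat q(t),\hat p(t))$, is isolated if there is $\delta>0$ such that every solution $(q(t),p(t))$ with $0<|q(0)-\hat q(0)|+|p(0)-\hat p(0)|<\delta$ is not $T$-periodic with winding number $N$. Degenerate case: there exists a curve $s\in\mathbb{R}\mapsto(q_s(0),p_s(0))\in\mathbb{R}^2$ such that, denoting by $(q_s(t),p_s(t))$ the solution of the system with this initial condition at $t=0$, the map $s\mapsto q_s(0)$ is continuous from $\mathbb{R}$ onto $\mathbb{R}$ and one-to-one on $[0,2\pi)$ (bijective onto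 its image, an interval of length $2\pi$), $q_{s+2\pi}(t)=q_s(t)+2\pi$, $p_{s+2\pi}(t)=p_s(t)$, and for every $s\in[0,2\pi)$ the solution $(q_s(t),p_s(t))$ is $T$-periodic with winding number $N$. The solutions $(q_s(t),p_s(t))$ are the degenerate solutions. Instability: let $P_N(q_0,p_0)=(q(T,q_0,p_0)-2N\pi,\;p(T,q_0,p_0))$, where $(q(t,q_0,p_0),p(t,q_0,p_0))$ is the solution with initial condition $(q_0,p_0)$ at $t=0$; $T$-periodic solutions with winding number $N$ correspond to fixed points of $P_N$. A fixed point $z$ of $P_N$ is stable if for every neighbourhood $V$ of $z$ there is a neighbourhood $W\subset V$ of $z$ with $P_N^n(W)\subset V$ for each $n>0$; otherwise it (and the corresponding solution) is unstable. *)

theory Defs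
  imports "HOL-Analysis.Analysis"
begin

section \<open>The equation and the equivalent first-order system\<close>

definition momentum :: "(real \<Rightarrow> real) \<Rightarrow> real \<Rightarrow> real" where
  "momentum x t = deriv x t / sqrt (1 - (deriv x t)\<^sup>2)"

definition pendulum_solution :: "real \<Rightarrow> (real \<Rightarrow> real) \<Rightarrow> (real \<Rightarrow> real) \<Rightarrow> bool" where
  "pendulum_solution a f x \<longleftrightarrow>
     (\<forall>t. x differentiable at t \<and> \<bar>deriv x t\<bar> < 1 \<and>
          momentum x differentiable at t \<and> deriv (momentum x) t + a * sin (x t) = f t)"

definition system_solution ::
  "real \<Rightarrow> (real \<Rightarrow> real) \<Rightarrow> (real \<Rightarrow> real) \<Rightarrow> (real \<Rightarrow> real) \<Rightarrow> bool" where
  "system_solution a f q p \<longleftrightarrow>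
     (\<forall>t. (q has_real_derivative p t / sqrt (1 + (p t)\<^sup>2)) (at t) \<and>
          (p has_real_derivative - a * sin (q t) + f t) (at t))"

lemma velocity_momentum_iff:
  fixes v p :: real
  shows "\<bar>v\<bar> < 1 \<and> p = v / sqrt (1 - v\<^sup>2) \<longleftrightarrow> v = p / sqrt (1 + p\<^sup>2)"
proof
  assume h: "\<bar>v\<bar> < 1 \<and> p = v / sqrt (1 - v\<^sup>2)"
  then have v: "1 - v\<^sup>2 > 0"
    by (simp add: abs_square_less_1)
  have "1 + p\<^sup>2 = 1 / (1 - v\<^sup>2)"
  proof -
    have "p\<^sup>2 = v\<^sup>2 / (1 - v\<^sup>2)"
      using h v by (simp add: power_divide)
    then show ?thesis
      using v by (simp add: field_simps)
  qed
  then have "sqrt (1 + p\<^sup>2) = 1 / sqrt (1 - v\<^sup>2)"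
    by (simp add: real_sqrt_divide)
  then show "v = p / sqrt (1 + p\<^sup>2)"
    using h v by simp
next
  assume h: "v = p / sqrt (1 + p\<^sup>2)"
  have p: "1 + p\<^sup>2 > 0"
    by (simp add: add_pos_nonneg)
  have "v\<^sup>2 = p\<^sup>2 / (1 + p\<^sup>2)"
    using h p by (simp add: power_divide)
  then have e: "1 - v\<^sup>2 = 1 / (1 + p\<^sup>2)"
    using p by (simp add: field_simps)
  then have "v\<^sup>2 < 1"
    using p by (smt (verit) divide_pos_pos)
  moreover have "sqrt (1 - v\<^sup>2) = 1 / sqrt (1 + p\<^sup>2)"
    using e by (simp add: real_sqrt_divide)
  then have "p = v / sqrt (1 - v\<^sup>2)"
    using h p by simp
  ultimately show "\<bar>v\<bar> < 1 \<and> p = v / sqrt (1 - v\<^sup>2)"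
    by (simp add: abs_square_less_1)
qed

lemma system_solution_iff:
  "system_solution a f x p \<longleftrightarrow> pendulum_solution a f x \<and> p = momentum x"
proof
  assume s: "system_solution a f x p"
  have d: "deriv x t = p t / sqrt (1 + (p t)\<^sup>2)" for t
    using s by (auto simp: system_solution_def intro: DERIV_imp_deriv)
  have v: "\<bar>deriv x t\<bar> < 1 \<and> p t = momentum x t" for t
    using velocity_momentum_iff[of "deriv x t" "p t"] d by (simp add: momentum_def)
  then have p: "p = momentum x"
    by blast
  have "deriv p t = - a * sin (x t) + f t" for t
    using s by (auto simp: system_solution_def intro: DERIV_imp_deriv)
  then show "pendulum_solution a f x \<and> p = momentum x"
    using s v p unfolding pendulum_solution_def system_solution_def
    by (auto simp: real_differentiable_def)
next
  assume h: "pendulum_solution a f x \<and> p = momentum x"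
  have "(x has_real_derivative deriv x t) (at t)" for t
    using h by (simp add: pendulum_solution_def DERIV_deriv_iff_real_differentiable)
  moreover have "deriv x t = p t / sqrt (1 + (p t)\<^sup>2)" for t
    using velocity_momentum_iff[of "deriv x t" "p t"] h
    by (simp add: pendulum_solution_def momentum_def)
  moreover have "(p has_real_derivative deriv p t) (at t)" for t
    using h by (simp add: pendulum_solution_def DERIV_deriv_iff_real_differentiable)
  moreover have "deriv p t = - a * sin (x t) + f t" for t
    using h by (auto simp: pendulum_solution_def algebra_simps dest: spec[of _ t])
  ultimately show "system_solution a f x p"
    by (simp add: system_solution_def)
qed


section \<open>Periodic solutions with winding number\<close>

definition periodic_solution ::
  "real \<Rightarrow> (real \<Rightarrow> real) \<Rightarrow> real \<Rightarrow> int \<Rightarrow> (real \<Rightarrow> real) \<Rightarrow> bool" where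
  "periodic_solution a f T N x \<longleftrightarrow>
     pendulum_solution a f x \<and> (\<forall>t. x (t + T) = x t + 2 * of_int N * pi)"

definition periodic_system_solution ::
  "real \<Rightarrow> (real \<Rightarrow> real) \<Rightarrow> real \<Rightarrow> int \<Rightarrow> (real \<Rightarrow> real) \<Rightarrow> (real \<Rightarrow> real) \<Rightarrow> bool" where
  "periodic_system_solution a f T N q p \<longleftrightarrow>
     system_solution a f q p \<and>
     (\<forall>t. q (t + T) = q t + 2 * of_int N * pi \<and> p (t + T) = p t)"

definition isolated_system_solution ::
  "real \<Rightarrow> (real \<Rightarrow> real) \<Rightarrow> real \<Rightarrow> int \<Rightarrow> (real \<Rightarrow> real) \<Rightarrow> (real \<Rightarrow> real) \<Rightarrow> bool" where
  "isolated_system_solution a f T N q\<^sub>0 p\<^sub>0 \<longleftrightarrow>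
     periodic_system_solution a f T N q\<^sub>0 p\<^sub>0 \<and>
     (\<exists>\<delta>>0. \<forall>q p. system_solution a f q p \<and>
        0 < \<bar>q 0 - q\<^sub>0 0\<bar> + \<bar>p 0 - p\<^sub>0 0\<bar> \<and> \<bar>q 0 - q\<^sub>0 0\<bar> + \<bar>p 0 - p\<^sub>0 0\<bar> < \<delta>
        \<longrightarrow> \<not> periodic_system_solution a f T N q p)"

definition isolated_periodic_solution ::
  "real \<Rightarrow> (real \<Rightarrow> real) \<Rightarrow> real \<Rightarrow> int \<Rightarrow> (real \<Rightarrow> real) \<Rightarrow> bool" where
  "isolated_periodic_solution a f T N x \<longleftrightarrow>
     periodic_solution a f T N x \<and> isolated_system_solution a f T N x (momentum x)"

definition shift_rel :: "((real \<Rightarrow> real) \<times> (real \<Rightarrow> real)) set" where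
  "shift_rel = {(x, y). \<exists>k::int. \<forall>t. y t = x t + 2 * of_int k * pi}"

text \<open>Degenerate solutions are never isolated, so finiteness of the number of isolated
  solutions alone is compatible with the degenerate case. The first conjunct makes the two cases
  genuine alternatives.\<close>

definition finitely_many_isolated ::
  "real \<Rightarrow> (real \<Rightarrow> real) \<Rightarrow> real \<Rightarrow> int \<Rightarrow> bool" where
  "finitely_many_isolated a f T N \<longleftrightarrow>
     (\<forall>x. periodic_solution a f T N x \<longrightarrow> isolated_periodic_solution a f T N x) \<and>
     finite ({x. isolated_periodic_solution a f T N x} // shift_rel)"


section \<open>The degenerate case\<close>

text \<open>\<open>q s\<close> and \<open>p s\<close> are the components of the solution starting at the point of the curve
  with parameter \<open>s\<close>.\<close>

definition degenerate_family ::
  "real \<Rightarrow> (real \<Rightarrow> real) \<Rightarrow> real \<Rightarrow> int \<Rightarrow>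
     (real \<Rightarrow> real \<Rightarrow> real) \<Rightarrow> (real \<Rightarrow> real \<Rightarrow> real) \<Rightarrow> bool" where
  "degenerate_family a f T N q p \<longleftrightarrow>
     (\<forall>s. system_solution a f (q s) (p s)) \<and>
     continuous_on UNIV (\<lambda>s. (q s 0, p s 0)) \<and>
     range (\<lambda>s. q s 0) = UNIV \<and>
     bij_betw (\<lambda>s. q s 0) {0..<2 * pi} {q 0 0..<q 0 0 + 2 * pi} \<and>
     (\<forall>s t. q (s + 2 * pi) t = q s t + 2 * pi \<and> p (s + 2 * pi) t = p s t) \<and>
     (\<forall>s\<in>{0..<2 * pi}. periodic_system_solution a f T N (q s) (p s))"

definition degenerate_case :: "real \<Rightarrow> (real \<Rightarrow> real) \<Rightarrow> real \<Rightarrow> int \<Rightarrow> bool" where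
  "degenerate_case a f T N \<longleftrightarrow> (\<exists>q p. degenerate_family a f T N q p)"

definition degenerate_solution ::
  "real \<Rightarrow> (real \<Rightarrow> real) \<Rightarrow> real \<Rightarrow> int \<Rightarrow> (real \<Rightarrow> real) \<Rightarrow> (real \<Rightarrow> real) \<Rightarrow> bool" where
  "degenerate_solution a f T N q p \<longleftrightarrow>
     (\<exists>Q P s. degenerate_family a f T N Q P \<and> q = Q s \<and> p = P s)"


section \<open>Stability\<close>

text \<open>The description is proper for continuous \<open>f\<close>: the right-hand side of the system is bounded
  on compact time intervals and Lipschitz in the state, so that every initial value problem has
  exactly one solution on the whole line.\<close>

definition flow_at :: "real \<Rightarrow> (real \<Rightarrow> real) \<Rightarrow> real \<Rightarrow> real \<times> real \<Rightarrow> real \<times> real" where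
  "flow_at a f t z =
     (THE w. \<exists>q p. system_solution a f q p \<and> (q 0, p 0) = z \<and> (q t, p t) = w)"

definition poincare_map ::
  "real \<Rightarrow> (real \<Rightarrow> real) \<Rightarrow> real \<Rightarrow> int \<Rightarrow> real \<times> real \<Rightarrow> real \<times> real" where
  "poincare_map a f T N z = flow_at a f T z - (2 * of_int N * pi, 0)"

definition stable_point :: "('a::topological_space \<Rightarrow> 'a) \<Rightarrow> 'a \<Rightarrow> bool" where
  "stable_point F z \<longleftrightarrow>
     (\<forall>V. open V \<and> z \<in> V \<longrightarrow>
        (\<exists>W. open W \<and> z \<in> W \<and> W \<subseteq> V \<and> (\<forall>n>0. (F ^^ n) ` W \<subseteq> V)))"

definition unstable_solution ::
  "real \<Rightarrow> (real \<Rightarrow> real) \<Rightarrow> real \<Rightarrow> int \<Rightarrow> (real \<Rightarrow> real) \<Rightarrow> (real \<Rightarrow> real) \<Rightarrow> bool" where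
  "unstable_solution a f T N q p \<longleftrightarrow> \<not> stable_point (poincare_map a f T N) (q 0, p 0)"

end

theory Submission
  imports Defs "HOL-Complex_Analysis.Conformal_Mappings"
begin

text \<open>
  A periodic solution with winding number \<open>N\<close> is a fixed point of the Poincare map \<open>P\<close>. Velocities
  are smaller than \<open>1\<close>, so nothing can be periodic when \<open>\<bar>2 N pi\<bar> \<ge> T\<close>. Otherwise write \<open>\<tau> z\<close> for
  the first component of \<open>P z - z\<close>.

  \<^emph>\<open>Reduction to one variable.\<close> For \<open>a \<le> (pi / T)\<^sup>2\<close> the map \<open>P\<close> twists: \<open>\<tau> (q, p)\<close> is strictly
  increasing in \<open>p\<close>. The difference of two solutions with the same initial position satisfies a
  linear system that is a Sturm minorant of \<open>x'' + (pi / T)\<^sup>2 x = 0\<close>, hence the two positions cannot meet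
  again up to time \<open>T\<close> (\<open>sturm_positive_or_rigid\<close>, \<open>twist\<close>). For fast initial momenta \<open>\<tau>\<close> has the
  sign of the momentum, so \<open>\<tau> = 0\<close> is the graph of a continuous \<open>2 pi\<close>-periodic function \<open>\<phi>\<close>, and the
  fixed points are the points \<open>(s, \<phi> s)\<close> at which the momentum also returns.

  \<^emph>\<open>Dichotomy.\<close> The system is analytic in the state. Its flow extends to complex initial states close
  to the real ones and is complex differentiable there. On the curve \<open>\<tau> = 0\<close> the derivative of
  \<open>\<tau>\<close> in direction \<open>p\<close> is positive: it could vanish only for \<open>a = (pi / T)\<^sup>2\<close> along an equilibrium of
  the unforced pendulum, which forces \<open>N = 0\<close> and \<open>f = 0\<close>, and this is what the restriction on \<open>f\<close> excludes.
  By the implicit function theorem \<open>\<phi>\<close> is locally the restriction of a holomorphic function, and so is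
  the defect of momentum along the curve. By the identity theorem the set of \<open>s\<close> with \<open>(s, \<phi> s)\<close>
  fixed contains a neighbourhood of each of its limit points
  (\<open>holomorphic_zero_set_locally_full\<close>); as the line is connected, the set has no limit points or is the
  whole line. In the first case all periodic solutions are isolated, and by compactness there
  are finitely many modulo \<open>2 pi\<close>. In the second case \<open>s \<mapsto> (s, \<phi> s)\<close> is a degenerate family.

  \<^emph>\<open>Instability.\<close> In the degenerate case the curve \<open>\<tau> = 0\<close> consists of fixed points and \<open>P\<close> maps the
  region \<open>\<tau> > 0\<close> above it into itself. There the position increases at each step. If a point of
  the curve were stable, a small open set just above it would have pairwise disjoint iterates inside a
  bounded set. This is impossible because \<open>P\<close> preserves area (\<open>unstable_curve_of_fixed_points\<close>).
\<close>

section \<open>Ordinary differential equations with Lipschitz right-hand side\<close>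

text \<open>The integral from \<open>0\<close> to \<open>t\<close> for either sign of \<open>t\<close>, so that solutions are obtained on the whole
  line at once.\<close>

definition signed_integral :: "(real \<Rightarrow> 'a::banach) \<Rightarrow> real \<Rightarrow> 'a" where
  "signed_integral g t = (if 0 \<le> t then integral {0..t} g else - integral {t..0} g)"

lemma signed_integral_0 [simp]: "signed_integral g 0 = 0"
  by (simp add: signed_integral_def)

lemma signed_integral_has_vector_derivative:
  fixes g :: "real \<Rightarrow> 'a::banach"
  assumes "continuous_on UNIV g"
  shows "(signed_integral g has_vector_derivative g t) (at t)"
proof -
  define b c where "b = min 0 t - 1" and "c = max 0 t + 1"
  have cont: "continuous_on {x..y} g" for x y
    using assms continuous_on_subset by blast
  have int: "g integrable_on {x..y}" for x y
    using cont integrable_continuous_real by blast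
  have eq: "signed_integral g u = integral {b..u} g - integral {b..0} g" if "u \<in> {b<..<c}" for u
  proof (cases "0 \<le> u")
    case True
    have "integral {b..0} g + integral {0..u} g = integral {b..u} g"
      by (rule Henstock_Kurzweil_Integration.integral_combine) (use True int in \<open>auto simp: b_def\<close>)
    then show ?thesis
      using True by (simp add: signed_integral_def algebra_simps)
  next
    case False
    have "integral {b..u} g + integral {u..0} g = integral {b..0} g"
      by (rule Henstock_Kurzweil_Integration.integral_combine) (use False int that in auto)
    then show ?thesis
      using False by (simp add: signed_integral_def algebra_simps)
  qed
  have t: "t \<in> {b<..<c}"
    by (auto simp: b_def c_def)
  have "((\<lambda>u. integral {b..u} g) has_vector_derivative g t) (at t within {b..c})"
    by (rule integral_has_vector_derivative[OF cont]) (use t in auto)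
  moreover have "at t within {b..c} = at t"
    by (rule at_within_interior) (use t in auto)
  ultimately have "((\<lambda>u. integral {b..u} g) has_vector_derivative g t) (at t)"
    by simp
  then have "((\<lambda>u. integral {b..u} g - integral {b..0} g) has_vector_derivative g t - 0) (at t)"
    by (intro has_vector_derivative_diff has_vector_derivative_const)
  then show ?thesis
    using has_vector_derivative_transform_within_open[of _ "g t" t "{b<..<c}" "signed_integral g"] t eq by simp
qed

lemma signed_integral_diff:
  fixes g h :: "real \<Rightarrow> 'a::banach"
  assumes "continuous_on UNIV g" "continuous_on UNIV h"
  shows "signed_integral (\<lambda>s. g s - h s) t = signed_integral g t - signed_integral h t"
proof -
  have "g integrable_on {x..y}" "h integrable_on {x..y}" for x y
    using assms continuous_on_subset integrable_continuous_real by blast+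
  then show ?thesis
    by (simp add: signed_integral_def Henstock_Kurzweil_Integration.integral_diff)
qed

lemma signed_integral_bound:
  fixes g :: "real \<Rightarrow> 'a::banach"
  assumes g: "continuous_on UNIV g" and "k > 0"
    and bnd: "\<And>s. norm (g s) \<le> K * exp (k * \<bar>s\<bar>)"
  shows "norm (signed_integral g t) \<le> K / k * exp (k * \<bar>t\<bar>)"
proof -
  have "0 \<le> K"
    using order_trans[OF norm_ge_zero bnd[of 0]] by simp
  have main: "norm (h t) \<le> K / k * exp (k * t)"
    if h: "\<And>s. (h has_vector_derivative h' s) (at s)" "h 0 = 0"
      "\<And>s. norm (h' s) \<le> K * exp (k * \<bar>s\<bar>)" and t: "t \<ge> 0"
    for t and h h' :: "real \<Rightarrow> 'a"
  proof (cases "t = 0")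
    case True
    then show ?thesis
      using \<open>h 0 = 0\<close> \<open>0 \<le> K\<close> \<open>k > 0\<close> by simp
  next
    case False
    have "norm (h t - h 0) \<le> K / k * exp (k * t) - K / k * exp (k * 0)"
    proof (rule differentiable_bound_general[where f' = h' and \<phi>' = "\<lambda>s. K * exp (k * s)"])
      show "continuous_on {0..t} h"
        using h(1) by (meson continuous_at_imp_continuous_on has_vector_derivative_continuous)
      show "((\<lambda>s. K / k * exp (k * s)) has_vector_derivative K * exp (k * x)) (at x)" for x
        unfolding has_real_derivative_iff_has_vector_derivative[symmetric]
        using \<open>k > 0\<close> by (auto intro!: derivative_eq_intros)
      show "norm (h' x) \<le> K * exp (k * x)" if "0 < x" for x
        using h(3)[of x] that by simp
    qed (use False t h \<open>k > 0\<close> in \<open>auto intro!: continuous_intros\<close>)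
    then show ?thesis
      using \<open>0 \<le> K\<close> \<open>k > 0\<close> \<open>h 0 = 0\<close> by (simp add: field_simps)
  qed
  show ?thesis
  proof (cases "0 \<le> t")
    case True
    then show ?thesis
      using main[OF signed_integral_has_vector_derivative[OF g] _ bnd True] by simp
  next
    case False
    have "((\<lambda>s. signed_integral g (- s)) has_vector_derivative - g (- s)) (at s)" for s
    proof -
      have "((signed_integral g \<circ> uminus) has_vector_derivative (- 1) *\<^sub>R g (- s)) (at s)"
        by (rule vector_diff_chain_at)
          (auto intro!: derivative_eq_intros signed_integral_has_vector_derivative[OF g])
      then show ?thesis
        by (simp add: o_def)
    qed
    from main[OF this, of "- t"] show ?thesis
      using False bnd[of "- _"] by simp
  qed
qed

text \<open>Picard iteration is a contraction with factor \<open>1/2\<close> for the weighted norm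
  \<open>sup \<bar>exp (- 2 L \<bar>t\<bar>) w t\<bar>\<close> (Bielecki), whatever the length of the time interval. Since the iteration
  acts on the deviation from the initial value, and \<open>X t 0\<close> is bounded, the weighted deviations are bounded
  continuous functions on the line.\<close>

theorem ode_global_existence:
  fixes X :: "real \<Rightarrow> 'a::banach \<Rightarrow> 'a"
  assumes cont: "\<And>v. continuous_on UNIV v \<Longrightarrow> continuous_on UNIV (\<lambda>t. X t (v t))"
    and lip: "\<And>t x y. norm (X t x - X t y) \<le> L * norm (x - y)" and "L > 0"
    and bnd: "\<And>t. norm (X t 0) \<le> M"
  shows "\<exists>u. u 0 = x\<^sub>0 \<and> (\<forall>t. (u has_vector_derivative X t (u t)) (at t))"
proof -
  define E where "E t = exp (2 * L * \<bar>t\<bar>)" for t :: real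
  have E: "continuous_on UNIV E" "E t \<ge> 1" for t
    unfolding E_def using \<open>L > 0\<close> by (auto intro!: continuous_intros)
  define G where "G w s = X s (x\<^sub>0 + E s *\<^sub>R apply_bcontfun w s)" for w s
  define F where "F w t = inverse (E t) *\<^sub>R signed_integral (G w) t" for w t
  have contG: "continuous_on UNIV (G w)" for w
    unfolding G_def by (intro cont continuous_intros E) simp
  have ointb: "norm (inverse (E t) *\<^sub>R signed_integral g t) \<le> K / (2 * L)"
    if "continuous_on UNIV g" "\<And>s. norm (g s) \<le> K * E s" for g :: "real \<Rightarrow> 'a" and K t
  proof -
    have "norm (signed_integral g t) \<le> K / (2 * L) * E t"
      using signed_integral_bound[of g "2 * L" K t] that \<open>L > 0\<close> by (simp add: E_def)
    then have "inverse (E t) * norm (signed_integral g t) \<le> inverse (E t) * (K / (2 * L) * E t)"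
      using E(2)[of t] by (intro mult_left_mono) auto
    then show ?thesis
      using E(2)[of t] by (auto simp: field_simps)
  qed
  have Fb: "F w \<in> bcontfun" for w
  proof (rule bcontfun_normI)
    have "continuous_on UNIV (signed_integral (G w))"
      using signed_integral_has_vector_derivative[OF contG]
      by (meson continuous_at_imp_continuous_on has_vector_derivative_continuous)
    moreover have "E t \<noteq> 0" for t
      using E(2)[of t] by auto
    ultimately show "continuous_on UNIV (F w)"
      unfolding F_def by (intro continuous_intros E) auto
    have "norm (G w s) \<le> (M + L * norm x\<^sub>0 + L * norm w) * E s" for s
    proof -
      have "norm (G w s) \<le> norm (X s 0) + norm (G w s - X s 0)"
        by (metis add.commute norm_triangle_sub)
      also have "norm (G w s - X s 0) \<le> L * norm (x\<^sub>0 + E s *\<^sub>R apply_bcontfun w s)"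
        using lip[of s _ 0] by (simp add: G_def)
      also have "norm (x\<^sub>0 + E s *\<^sub>R apply_bcontfun w s) \<le> norm x\<^sub>0 + E s * norm w"
      proof -
        have "norm (E s *\<^sub>R apply_bcontfun w s) \<le> E s * norm w"
          using norm_bounded[of w s] E(2)[of s] by (auto intro: mult_left_mono)
        then show ?thesis
          using norm_triangle_ineq[of x\<^sub>0 "E s *\<^sub>R apply_bcontfun w s"] by linarith
      qed
      finally have "norm (G w s) \<le> M + L * norm x\<^sub>0 + L * norm w * E s"
        using bnd[of s] \<open>L > 0\<close> by (simp add: algebra_simps)
      moreover have "0 \<le> M + L * norm x\<^sub>0"
        using order_trans[OF norm_ge_zero bnd] \<open>L > 0\<close> by simp
      then have "(M + L * norm x\<^sub>0) * 1 \<le> (M + L * norm x\<^sub>0) * E s"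
        using E(2) by (intro mult_left_mono) auto
      ultimately show ?thesis
        by (simp add: algebra_simps)
    qed
    then show "norm (F w t) \<le> (M + L * norm x\<^sub>0 + L * norm w) / (2 * L)" for t
      unfolding F_def by (rule ointb[OF contG])
  qed
  have "\<exists>!w. Bcontfun (F w) = w"
  proof (rule banach_fix_type[of "1/2"]; (intro allI)?)
    fix v w
    have "norm (F v t - F w t) \<le> L * norm (v - w) / (2 * L)" for t
    proof -
      have "norm (G v s - G w s) \<le> L * norm (v - w) * E s" for s
      proof -
        have "norm (G v s - G w s) \<le> L * norm (E s *\<^sub>R (apply_bcontfun v s - apply_bcontfun w s))"
          unfolding G_def by (rule order_trans[OF lip]) (simp add: algebra_simps)
        also have "\<dots> \<le> L * (E s * norm (v - w))"
          using norm_bounded[of "v - w" s] E(2)[of s] \<open>L > 0\<close>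
          by (intro mult_left_mono) (auto intro: mult_left_mono)
        finally show ?thesis
          by (simp add: algebra_simps)
      qed
      then have "norm (inverse (E t) *\<^sub>R signed_integral (\<lambda>s. G v s - G w s) t) \<le> L * norm (v - w) / (2 * L)"
        by (intro ointb continuous_intros contG)
      then show ?thesis
        by (simp add: F_def signed_integral_diff[OF contG contG] scaleR_diff_right)
    qed
    then show "dist (Bcontfun (F v)) (Bcontfun (F w)) \<le> 1 / 2 * dist v w"
      using \<open>L > 0\<close> by (intro dist_bound) (simp add: Bcontfun_inverse[OF Fb] dist_norm)
  qed auto
  then obtain w where "Bcontfun (F w) = w"
    by blast
  then have w: "apply_bcontfun w = F w"
    by (metis Fb Bcontfun_inverse)
  define u where "u t = x\<^sub>0 + signed_integral (G w) t" for t
  have "E t \<noteq> 0" for t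
    using E(2)[of t] by auto
  then have "G w t = X t (u t)" for t
    by (simp add: G_def u_def w F_def)
  moreover have "(u has_vector_derivative 0 + G w t) (at t)" for t
    unfolding u_def
    by (intro has_vector_derivative_add has_vector_derivative_const signed_integral_has_vector_derivative contG)
  ultimately show ?thesis
    by (intro exI[of _ u]) (simp add: u_def)
qed

lemma gronwall:
  fixes u u' :: "real \<Rightarrow> real"
  assumes der: "\<And>t. 0 \<le> t \<Longrightarrow> t \<le> T \<Longrightarrow> (u has_real_derivative u' t) (at t)"
    and bnd: "\<And>t. 0 \<le> t \<Longrightarrow> t \<le> T \<Longrightarrow> u' t \<le> K * u t + c"
    and "K > 0" "c \<ge> 0" and t: "0 \<le> t" "t \<le> T"
  shows "u t \<le> (u 0 + c / K) * exp (K * t)"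
proof -
  have "(u 0 + c / K) * exp (- K * 0) \<ge> (u t + c / K) * exp (- K * t)"
  proof (rule DERIV_nonpos_imp_nonincreasing[OF t(1)], intro exI conjI)
    fix x assume x: "0 \<le> x" "x \<le> t"
    show "((\<lambda>x. (u x + c / K) * exp (- K * x)) has_real_derivative
        (u' x - (K * u x + c)) * exp (- K * x)) (at x)"
      using x t \<open>K > 0\<close>
      by (auto intro!: derivative_eq_intros der simp: field_simps)
    show "(u' x - (K * u x + c)) * exp (- K * x) \<le> 0"
      using bnd[of x] x t by (auto intro!: mult_nonpos_nonneg)
  qed
  then have "(u t + c / K) * exp (- K * t) * exp (K * t) \<le> (u 0 + c / K) * exp (K * t)"
    by (intro mult_right_mono) auto
  moreover have "(u t + c / K) * exp (- K * t) * exp (K * t) = u t + c / K"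
    by (simp add: mult.assoc exp_add[symmetric])
  moreover have "c / K \<ge> 0"
    using \<open>K > 0\<close> \<open>c \<ge> 0\<close> by simp
  ultimately show ?thesis
    by linarith
qed

text \<open>The square of the norm is differentiable where the norm is not; the price is the exponent
  \<open>L + 1\<close> in place of \<open>L\<close>, from \<open>2 c \<bar>w\<bar> \<le> \<bar>w\<bar>\<^sup>2 + c\<^sup>2\<close>.\<close>

lemma gronwall_norm:
  fixes w w' :: "real \<Rightarrow> 'a::real_inner"
  assumes der: "\<And>t. 0 \<le> t \<Longrightarrow> t \<le> T \<Longrightarrow> (w has_vector_derivative w' t) (at t)"
    and bnd: "\<And>t. 0 \<le> t \<Longrightarrow> t \<le> T \<Longrightarrow> norm (w' t) \<le> L * norm (w t) + c"
    and "L \<ge> 0" "c \<ge> 0" and t: "0 \<le> t" "t \<le> T"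
  shows "norm (w t) \<le> (norm (w 0) + c) * exp ((L + 1) * t)"
proof -
  have "(norm (w t))\<^sup>2 \<le> ((norm (w 0))\<^sup>2 + c\<^sup>2 / (2 * L + 1)) * exp ((2 * L + 1) * t)"
  proof (rule gronwall[where u' = "\<lambda>t. 2 * (w t \<bullet> w' t)" and T = T])
    fix s assume s: "0 \<le> s" "s \<le> T"
    have "((\<lambda>t. w t \<bullet> w t) has_derivative (\<lambda>h. w s \<bullet> (h *\<^sub>R w' s) + (h *\<^sub>R w' s) \<bullet> w s)) (at s)"
      using der[OF s] unfolding has_vector_derivative_def by (intro has_derivative_inner)
    then show "((\<lambda>t. (norm (w t))\<^sup>2) has_real_derivative 2 * (w s \<bullet> w' s)) (at s)"
      unfolding has_field_derivative_def dot_square_norm[symmetric]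
      by (rule has_derivative_eq_rhs) (auto simp: inner_commute algebra_simps)
    have "w s \<bullet> w' s \<le> norm (w s) * norm (w' s)"
      by (rule norm_cauchy_schwarz)
    also have "\<dots> \<le> norm (w s) * (L * norm (w s) + c)"
      using bnd[OF s] by (intro mult_left_mono) auto
    finally have "2 * (w s \<bullet> w' s) \<le> 2 * L * (norm (w s))\<^sup>2 + 2 * norm (w s) * c"
      by (simp add: power2_eq_square algebra_simps)
    also have "2 * norm (w s) * c \<le> (norm (w s))\<^sup>2 + c\<^sup>2"
      by (rule sum_squares_bound)
    finally show "2 * (w s \<bullet> w' s) \<le> (2 * L + 1) * (norm (w s))\<^sup>2 + c\<^sup>2"
      by (simp add: algebra_simps)
  qed (use \<open>L \<ge> 0\<close> t in auto)
  also have "\<dots> \<le> (norm (w 0) + c)\<^sup>2 * (exp ((L + 1) * t))\<^sup>2"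
  proof (intro mult_mono)
    have "c\<^sup>2 / (2 * L + 1) \<le> c\<^sup>2 / 1"
      using \<open>L \<ge> 0\<close> by (intro divide_left_mono) auto
    moreover have "0 \<le> norm (w 0) * c"
      using \<open>c \<ge> 0\<close> by simp
    ultimately show "(norm (w 0))\<^sup>2 + c\<^sup>2 / (2 * L + 1) \<le> (norm (w 0) + c)\<^sup>2"
      by (simp add: power2_sum)
    have "(2 * L + 1) * t \<le> 2 * ((L + 1) * t)"
      using t by (simp add: algebra_simps)
    then show "exp ((2 * L + 1) * t) \<le> (exp ((L + 1) * t))\<^sup>2"
      by (simp add: exp_double[symmetric])
  qed auto
  finally have "(norm (w t))\<^sup>2 \<le> ((norm (w 0) + c) * exp ((L + 1) * t))\<^sup>2"
    by (simp add: power_mult_distrib)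
  then show ?thesis
    by (rule power2_le_imp_le) (use \<open>c \<ge> 0\<close> in auto)
qed

lemma ode_lipschitz_dependence:
  fixes X :: "real \<Rightarrow> 'a::real_inner \<Rightarrow> 'a"
  assumes "\<And>t. (u has_vector_derivative X t (u t)) (at t)"
    and "\<And>t. (v has_vector_derivative X t (v t)) (at t)"
    and lip: "\<And>t x y. norm (X t x - X t y) \<le> L * norm (x - y)"
    and "L \<ge> 0" "t \<ge> 0"
  shows "norm (u t - v t) \<le> exp ((L + 1) * t) * norm (u 0 - v 0)"
proof -
  have "norm (u t - v t) \<le> (norm (u 0 - v 0) + 0) * exp ((L + 1) * t)"
    by (rule gronwall_norm[where T = t and w' = "\<lambda>t. X t (u t) - X t (v t)"])
      (use assms in \<open>auto intro!: has_vector_derivative_diff\<close>)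
  then show ?thesis
    by (simp add: mult.commute)
qed

lemma ode_uniqueness:
  fixes X :: "real \<Rightarrow> 'a::real_inner \<Rightarrow> 'a"
  assumes u: "\<And>t. (u has_vector_derivative X t (u t)) (at t)"
    and v: "\<And>t. (v has_vector_derivative X t (v t)) (at t)"
    and lip: "\<And>t x y. norm (X t x - X t y) \<le> L * norm (x - y)"
    and "L \<ge> 0" and "u s = v s"
  shows "u t = v t"
proof (cases "s \<le> t")
  case True
  have "((\<lambda>r. w (s + r)) has_vector_derivative X (s + r) (w (s + r))) (at r)"
    if w: "\<And>t. (w has_vector_derivative X t (w t)) (at t)" for w r
  proof -
    have "((\<lambda>r. s + r) has_vector_derivative 1) (at r)"
      by (auto simp flip: has_real_derivative_iff_has_vector_derivative intro!: derivative_eq_intros)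
    from vector_diff_chain_at[OF this w] show ?thesis
      by (simp add: o_def)
  qed
  from ode_lipschitz_dependence[OF this[OF u] this[OF v] lip, of "t - s"]
  show ?thesis
    using True \<open>u s = v s\<close> \<open>L \<ge> 0\<close> by simp
next
  case False
  have "((\<lambda>r. w (s - r)) has_vector_derivative - X (s - r) (w (s - r))) (at r)"
    if w: "\<And>t. (w has_vector_derivative X t (w t)) (at t)" for w r
  proof -
    have "((\<lambda>r. s - r) has_vector_derivative - 1) (at r)"
      by (auto simp flip: has_real_derivative_iff_has_vector_derivative intro!: derivative_eq_intros)
    from vector_diff_chain_at[OF this w] show ?thesis
      by (simp add: o_def)
  qed
  from ode_lipschitz_dependence[of _ "\<lambda>r x. - X (s - r) x", OF this[OF u] this[OF v], of L "s - t"]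
  show ?thesis
    using False \<open>u s = v s\<close> \<open>L \<ge> 0\<close> lip by (simp add: norm_minus_commute)
qed

text \<open>The remainder \<open>u 1 - u 2 - m\<close> satisfies the variational equation along \<open>u 0\<close> up to a quadratic error, and
  starts from \<open>0\<close>. The estimate compares two arbitrary solutions near \<open>u 0\<close> rather than one solution with
  \<open>u 0\<close>: this strict differentiability makes the implicit function theorem available without a separate proof
  that the derivative is continuous.\<close>

lemma ode_strict_derivative:
  fixes X :: "real \<Rightarrow> 'a::real_inner \<Rightarrow> 'a"
  assumes sol: "\<And>i t. i < (3::nat) \<Longrightarrow> (u i has_vector_derivative X t (u i t)) (at t)"
    and lip: "\<And>t x y. norm (X t x - X t y) \<le> L * norm (x - y)"
    and m: "\<And>t. (m has_vector_derivative A t (m t)) (at t)" "m 0 = u 1 0 - u 2 0"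
    and A: "\<And>t. linear (A t)" "\<And>t x. norm (A t x) \<le> L * norm x"
    and second: "\<And>t. 0 \<le> t \<Longrightarrow> t \<le> T \<Longrightarrow>
      norm (X t (u 1 t) - X t (u 2 t) - A t (u 1 t - u 2 t)) \<le>
        C * (norm (u 1 t - u 0 t) + norm (u 2 t - u 0 t)) * norm (u 1 t - u 2 t)"
    and "L \<ge> 0" "C \<ge> 0" "T \<ge> 0"
  shows "norm (u 1 T - u 2 T - m T) \<le> C * exp ((L + 1) * T) ^ 3 *
      (norm (u 1 0 - u 0 0) + norm (u 2 0 - u 0 0)) * norm (u 1 0 - u 2 0)"
proof -
  define E where "E = exp ((L + 1) * T)"
  define D where "D = (norm (u 1 0 - u 0 0) + norm (u 2 0 - u 0 0)) * norm (u 1 0 - u 2 0)"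
  have dep: "norm (u i t - u j t) \<le> E * norm (u i 0 - u j 0)"
    if "0 \<le> t" "t \<le> T" "i < 3" "j < 3" for t i j
  proof -
    have "norm (u i t - u j t) \<le> exp ((L + 1) * t) * norm (u i 0 - u j 0)"
      using that \<open>L \<ge> 0\<close> by (intro ode_lipschitz_dependence[OF sol sol lip]) auto
    also have "\<dots> \<le> E * norm (u i 0 - u j 0)"
      using that \<open>L \<ge> 0\<close> unfolding E_def by (intro mult_right_mono) (auto intro: mult_left_mono)
    finally show ?thesis .
  qed
  let ?r = "\<lambda>t. u 1 t - u 2 t - m t"
  have "norm (?r T) \<le> (norm (?r 0) + C * E\<^sup>2 * D) * exp ((L + 1) * T)"
  proof (rule gronwall_norm[where T = T])
    fix t assume t: "0 \<le> t" "t \<le> T"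
    show "(?r has_vector_derivative X t (u 1 t) - X t (u 2 t) - A t (m t)) (at t)"
      by (intro has_vector_derivative_diff sol m) auto
    have "X t (u 1 t) - X t (u 2 t) - A t (m t) =
        A t (?r t) + (X t (u 1 t) - X t (u 2 t) - A t (u 1 t - u 2 t))"
      by (simp add: linear_diff[OF A(1)])
    also have "norm \<dots> \<le> L * norm (?r t) +
        C * (norm (u 1 t - u 0 t) + norm (u 2 t - u 0 t)) * norm (u 1 t - u 2 t)"
      by (rule norm_triangle_le, rule add_mono[OF A(2) second[OF t]])
    also have "C * (norm (u 1 t - u 0 t) + norm (u 2 t - u 0 t)) * norm (u 1 t - u 2 t) \<le>
        C * (E * norm (u 1 0 - u 0 0) + E * norm (u 2 0 - u 0 0)) * (E * norm (u 1 0 - u 2 0))"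
      using \<open>C \<ge> 0\<close> t by (intro mult_mono add_mono mult_nonneg_nonneg dep order_refl) (auto simp: E_def)
    also have "\<dots> = C * E\<^sup>2 * D"
      by (simp add: D_def power2_eq_square algebra_simps)
    finally show "norm (X t (u 1 t) - X t (u 2 t) - A t (m t)) \<le> L * norm (?r t) + C * E\<^sup>2 * D"
      by simp
  qed (use assms in \<open>auto simp: D_def\<close>)
  then show ?thesis
    using m(2) by (simp add: E_def D_def power3_eq_cube power2_eq_square mult_ac)
qed

section \<open>The relativistic velocity and its extension to a complex strip\<close>

text \<open>Mean value inequality for \<open>h - h' w\<^sub>0\<close> on the segment from \<open>w\<^sub>1\<close> to \<open>w\<^sub>2\<close>. It feeds the second-order hypothesis of
  \<open>ode_strict_derivative\<close>.\<close>

lemma strict_derivative_bound: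
  fixes h h' :: "'a::real_normed_field \<Rightarrow> 'a"
  assumes "convex S" and der: "\<And>z. z \<in> S \<Longrightarrow> (h has_field_derivative h' z) (at z)"
    and lip: "\<And>x y. x \<in> S \<Longrightarrow> y \<in> S \<Longrightarrow> norm (h' x - h' y) \<le> K * norm (x - y)"
    and "K \<ge> 0" and w: "w\<^sub>0 \<in> S" "w\<^sub>1 \<in> S" "w\<^sub>2 \<in> S"
  shows "norm (h w\<^sub>1 - h w\<^sub>2 - h' w\<^sub>0 * (w\<^sub>1 - w\<^sub>2))
    \<le> K * (norm (w\<^sub>1 - w\<^sub>0) + norm (w\<^sub>2 - w\<^sub>0)) * norm (w\<^sub>1 - w\<^sub>2)"
proof -
  have seg: "closed_segment w\<^sub>1 w\<^sub>2 \<subseteq> S"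
    using \<open>convex S\<close> w by (simp add: closed_segment_subset)
  have "norm ((h w\<^sub>1 - h' w\<^sub>0 * w\<^sub>1) - (h w\<^sub>2 - h' w\<^sub>0 * w\<^sub>2))
      \<le> K * (norm (w\<^sub>1 - w\<^sub>0) + norm (w\<^sub>2 - w\<^sub>0)) * norm (w\<^sub>1 - w\<^sub>2)"
  proof (rule field_differentiable_bound[where S = "closed_segment w\<^sub>1 w\<^sub>2" and f' = "\<lambda>z. h' z - h' w\<^sub>0"])
    fix z assume z: "z \<in> closed_segment w\<^sub>1 w\<^sub>2"
    have "((\<lambda>z. h z - h' w\<^sub>0 * z) has_field_derivative h' z - h' w\<^sub>0) (at z)"
      using der[of z] seg z by (auto intro!: derivative_eq_intros)
    then show "((\<lambda>z. h z - h' w\<^sub>0 * z) has_field_derivative h' z - h' w\<^sub>0) (at z within closed_segment w\<^sub>1 w\<^sub>2)"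
      by (rule has_field_derivative_at_within)
    obtain u where u: "0 \<le> u" "u \<le> 1" "z = (1 - u) *\<^sub>R w\<^sub>1 + u *\<^sub>R w\<^sub>2"
      using z by (auto simp: closed_segment_def)
    have "z - w\<^sub>0 = (1 - u) *\<^sub>R (w\<^sub>1 - w\<^sub>0) + u *\<^sub>R (w\<^sub>2 - w\<^sub>0)"
      unfolding u(3) by (simp add: algebra_simps)
    also have "norm \<dots> \<le> (1 - u) * norm (w\<^sub>1 - w\<^sub>0) + u * norm (w\<^sub>2 - w\<^sub>0)"
      using u by (intro order_trans[OF norm_triangle_ineq]) simp
    also have "\<dots> \<le> 1 * norm (w\<^sub>1 - w\<^sub>0) + 1 * norm (w\<^sub>2 - w\<^sub>0)"
      using u by (intro add_mono mult_right_mono) auto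
    finally have "K * norm (z - w\<^sub>0) \<le> K * (norm (w\<^sub>1 - w\<^sub>0) + norm (w\<^sub>2 - w\<^sub>0))"
      using \<open>K \<ge> 0\<close> by (intro mult_left_mono) auto
    then show "norm (h' z - h' w\<^sub>0) \<le> K * (norm (w\<^sub>1 - w\<^sub>0) + norm (w\<^sub>2 - w\<^sub>0))"
      using lip[of z w\<^sub>0] seg z w by auto
  qed auto
  then show ?thesis
    by (simp add: algebra_simps)
qed

definition vel :: "real \<Rightarrow> real" where
  "vel p = p / sqrt (1 + p\<^sup>2)"

text \<open>A strip around the real axis on which \<open>p \<mapsto> p / sqrt (1 + p\<^sup>2)\<close> is holomorphic (its singularities are
  \<open>\<plusminus> \<i>\<close>) and on which this function, the sine and their first derivatives are Lipschitz.\<close>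

definition strip :: "complex set" where
  "strip = {z. \<bar>Im z\<bar> \<le> 1 / 2}"

text \<open>The nearest point of the strip. Composing the complex vector field with this projection makes it globally
  Lipschitz, hence gives it a global flow, without changing it at points of the strip.\<close>

definition clamp_strip :: "complex \<Rightarrow> complex" where
  "clamp_strip z = Complex (Re z) (max (- 1 / 2) (min (1 / 2) (Im z)))"

definition cvel :: "complex \<Rightarrow> complex" where
  "cvel p = p / csqrt (1 + p\<^sup>2)"

definition cvel' :: "complex \<Rightarrow> complex" where
  "cvel' p = 1 / csqrt (1 + p\<^sup>2) ^ 3"

lemma one_plus_square_pos: "1 + (p::real)\<^sup>2 > 0"
  by (simp add: add_pos_nonneg)

lemma vel_has_derivative: "(vel has_real_derivative 1 / sqrt (1 + p\<^sup>2) ^ 3) (at p)"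
proof -
  define u where "u = sqrt (1 + p\<^sup>2)"
  have "u > 0" "u\<^sup>2 = 1 + p\<^sup>2"
    using one_plus_square_pos[of p] by (auto simp: u_def)
  have "((\<lambda>p. 1 + p\<^sup>2) has_real_derivative 2 * p) (at p)"
    by (auto intro!: derivative_eq_intros)
  from DERIV_chain2[OF DERIV_real_sqrt[OF one_plus_square_pos] this]
  have "((\<lambda>p. sqrt (1 + p\<^sup>2)) has_real_derivative inverse u / 2 * (2 * p)) (at p)"
    unfolding u_def .
  from DERIV_divide[OF DERIV_ident this]
  have "((\<lambda>p. p / sqrt (1 + p\<^sup>2)) has_real_derivative (1 * u - p * (inverse u / 2 * (2 * p))) / (u * u)) (at p)"
    using \<open>u > 0\<close> by (simp add: u_def)
  also have "(1 * u - p * (inverse u / 2 * (2 * p))) / (u * u) = (u\<^sup>2 - p\<^sup>2) / u ^ 3"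
    using \<open>u > 0\<close> by (simp add: field_simps power2_eq_square power3_eq_cube)
  finally show ?thesis
    by (simp add: \<open>u\<^sup>2 = 1 + p\<^sup>2\<close> vel_def[abs_def] flip: u_def)
qed

lemma sqrt_one_plus_square_ge: "sqrt (1 + p\<^sup>2) ^ 3 \<ge> 1"
  by simp

lemma vel_mono: "p < p' \<Longrightarrow> vel p < vel p'"
proof (erule DERIV_pos_imp_increasing)
  show "\<exists>y. (vel has_real_derivative y) (at x) \<and> 0 < y" for x
    by (rule exI[of _ "1 / sqrt (1 + x\<^sup>2) ^ 3"])
      (use vel_has_derivative one_plus_square_pos in simp)
qed

lemma abs_vel_less: "\<bar>vel p\<bar> < 1"
proof -
  have "\<bar>p\<bar> < sqrt (1 + p\<^sup>2)"
    by (rule real_less_rsqrt) simp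
  then have "\<bar>p\<bar> / sqrt (1 + p\<^sup>2) < 1"
    by (subst divide_less_eq_1_pos) (simp_all only: real_sqrt_gt_0_iff one_plus_square_pos)
  moreover have "\<bar>vel p\<bar> = \<bar>p\<bar> / sqrt (1 + p\<^sup>2)"
    unfolding vel_def abs_divide using real_sqrt_gt_0_iff[THEN iffD2, OF one_plus_square_pos[of p]]
    by (simp only: abs_of_pos)
  ultimately show ?thesis
    by simp
qed

lemma vel_lipschitz: "\<bar>vel p - vel p'\<bar> \<le> \<bar>p - p'\<bar>"
proof -
  have "norm (1 / sqrt (1 + z\<^sup>2) ^ 3) \<le> 1" for z
  proof -
    have "1 / sqrt (1 + z\<^sup>2) ^ 3 \<le> 1 / 1"
      by (rule divide_left_mono[OF sqrt_one_plus_square_ge]) (simp_all add: one_plus_square_pos)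
    then show ?thesis
      by (simp add: norm_divide norm_power)
  qed
  from field_differentiable_bound[of UNIV vel "\<lambda>p. 1 / sqrt (1 + p\<^sup>2) ^ 3" 1 p p', OF _ _ this]
  show ?thesis
    using vel_has_derivative by simp
qed

text \<open>By \<open>velocity_momentum_iff\<close> the bound on \<open>p\<close> is the momentum of velocity \<open>c\<close>.\<close>

lemma vel_gt:
  assumes "\<bar>c\<bar> < 1" and "p > c / sqrt (1 - c\<^sup>2)"
  shows "vel p > c"
proof -
  have "c = vel (c / sqrt (1 - c\<^sup>2))"
    unfolding vel_def by (rule velocity_momentum_iff[THEN iffD1]) (use assms in blast)
  then show ?thesis
    using vel_mono[OF assms(2)] by metis
qed

lemma convex_strip: "convex strip"
proof -
  have "strip = {z. Im z \<le> 1 / 2} \<inter> {z. Im z \<ge> - (1 / 2)}"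
    by (auto simp: strip_def)
  show ?thesis
    unfolding \<open>strip = _\<close> by (intro convex_Int convex_halfspace_Im_le convex_halfspace_Im_ge)
qed

lemma clamp_strip_in [simp]: "clamp_strip z \<in> strip"
  by (auto simp: strip_def clamp_strip_def)

lemma clamp_strip_id: "z \<in> strip \<Longrightarrow> clamp_strip z = z"
  by (auto simp: strip_def clamp_strip_def complex_eq_iff)

lemma clamp_strip_of_real [simp]: "clamp_strip (of_real x) = of_real x"
  by (rule clamp_strip_id) (simp add: strip_def)

lemma clamp_strip_lipschitz: "norm (clamp_strip x - clamp_strip y) \<le> norm (x - y)"
proof -
  have "\<bar>max (- 1 / 2) (min (1 / 2) (Im x)) - max (- 1 / 2) (min (1 / 2) (Im y))\<bar> \<le> \<bar>Im x - Im y\<bar>"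
    by linarith
  then have "(max (- 1 / 2) (min (1 / 2) (Im x)) - max (- 1 / 2) (min (1 / 2) (Im y)))\<^sup>2 \<le> (Im x - Im y)\<^sup>2"
    by (rule abs_le_square_iff[THEN iffD1])
  then show ?thesis
    unfolding cmod_def clamp_strip_def minus_complex.sel complex.sel
    by (intro real_sqrt_le_mono add_mono order_refl)
qed

lemma cvel_of_real: "cvel (of_real p) = of_real (vel p)"
  using csqrt_of_real[of "1 + p\<^sup>2"] by (simp add: cvel_def vel_def)

lemma cvel'_of_real: "cvel' (of_real p) = of_real (1 / sqrt (1 + p\<^sup>2) ^ 3)"
  using csqrt_of_real[of "1 + p\<^sup>2"] by (simp add: cvel'_def)

lemma csqrt_strip:
  assumes "p \<in> strip"
  shows "1 + p\<^sup>2 \<notin> \<real>\<^sub>\<le>\<^sub>0" and "norm (csqrt (1 + p\<^sup>2)) \<ge> 4 / 5"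
proof -
  have "(Im p)\<^sup>2 \<le> (1 / 2)\<^sup>2"
    using assms by (subst abs_le_square_iff[symmetric]) (simp add: strip_def)
  then have re: "Re (1 + p\<^sup>2) \<ge> 3 / 4"
    by (simp add: power2_eq_square) (smt (verit) zero_le_square)
  then show "1 + p\<^sup>2 \<notin> \<real>\<^sub>\<le>\<^sub>0"
    by (auto simp: complex_nonpos_Reals_iff)
  have "(4 / 5)\<^sup>2 \<le> norm (1 + p\<^sup>2)"
    using re complex_Re_le_cmod[of "1 + p\<^sup>2"] by (simp add: power2_eq_square)
  also have "\<dots> = (norm (csqrt (1 + p\<^sup>2)))\<^sup>2"
    by (simp flip: norm_power)
  finally show "norm (csqrt (1 + p\<^sup>2)) \<ge> 4 / 5"
    by (rule power2_le_imp_le) simp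
qed

lemma cvel_has_derivative:
  assumes "p \<in> strip"
  shows "(cvel has_field_derivative cvel' p) (at p)"
proof -
  define u where "u = csqrt (1 + p\<^sup>2)"
  have u: "u \<noteq> 0" "u\<^sup>2 = 1 + p\<^sup>2"
    using csqrt_strip[OF assms] by (auto simp: u_def)
  have "((\<lambda>p. p / csqrt (1 + p\<^sup>2)) has_field_derivative (1 * u - p * (2 * p / (2 * u))) / (u * u)) (at p)"
    using csqrt_strip(1)[OF assms] u(1) unfolding u_def
    by (auto intro!: derivative_eq_intros)
  also have "(1 * u - p * (2 * p / (2 * u))) / (u * u) = (u\<^sup>2 - p\<^sup>2) / u ^ 3"
    using u by (simp add: field_simps power2_eq_square power3_eq_cube)
  finally show ?thesis
    by (simp add: u cvel_def[abs_def] cvel'_def flip: u_def)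
qed

lemma cvel'_bound:
  assumes "p \<in> strip"
  shows "norm (cvel' p) \<le> 2"
proof -
  have "(4 / 5) ^ 3 \<le> norm (csqrt (1 + p\<^sup>2)) ^ 3"
    using csqrt_strip[OF assms] by (intro power_mono) auto
  then have "1 \<le> 2 * norm (csqrt (1 + p\<^sup>2)) ^ 3"
    by (simp add: power3_eq_cube)
  then show ?thesis
    using csqrt_strip[OF assms] by (simp add: cvel'_def norm_divide norm_power divide_le_eq)
qed

lemma cvel_lipschitz:
  assumes "x \<in> strip" "y \<in> strip"
  shows "norm (cvel x - cvel y) \<le> 2 * norm (x - y)"
  by (rule field_differentiable_bound[OF convex_strip _ cvel'_bound assms])
    (auto intro: has_field_derivative_at_within cvel_has_derivative)

text \<open>With \<open>u\<^sup>2 = 1 + p\<^sup>2\<close> the second derivative of \<open>cvel\<close> is \<open>- 3 p / u^5\<close>. On the strip \<open>\<bar>u\<bar> \<ge> 4/5\<close> and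
  \<open>\<bar>p\<bar> \<le> 1 + \<bar>u\<bar>\<^sup>2 / 2\<close>, which bounds it by \<open>13\<close>.\<close>

lemma cvel'_lipschitz:
  assumes "x \<in> strip" "y \<in> strip"
  shows "norm (cvel' x - cvel' y) \<le> 13 * norm (x - y)"
proof (rule field_differentiable_bound[OF convex_strip _ _ assms])
  fix p assume p: "p \<in> strip"
  define u where "u = csqrt (1 + p\<^sup>2)"
  have u: "u \<noteq> 0" "u\<^sup>2 = 1 + p\<^sup>2" "norm u \<ge> 4 / 5"
    using csqrt_strip[OF p] by (auto simp: u_def)
  have "((\<lambda>p. 1 / csqrt (1 + p\<^sup>2) ^ 3) has_field_derivative
      (0 * u ^ 3 - 1 * (3 * (2 * p / (2 * u)) * u ^ 2)) / (u ^ 3 * u ^ 3)) (at p)"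
    using csqrt_strip(1)[OF p] u(1) unfolding u_def
    by (auto intro!: derivative_eq_intros simp: power2_eq_square)
  also have "(0 * u ^ 3 - 1 * (3 * (2 * p / (2 * u)) * u ^ 2)) / (u ^ 3 * u ^ 3) = - 3 * p / u ^ 5"
    using u(1) by (simp add: field_simps eval_nat_numeral)
  finally have "(cvel' has_field_derivative - 3 * p / u ^ 5) (at p)"
    by (simp add: cvel'_def[abs_def])
  then show "(cvel' has_field_derivative - 3 * p / csqrt (1 + p\<^sup>2) ^ 5) (at p within strip)"
    unfolding u_def by (rule has_field_derivative_at_within)
  have "(norm p)\<^sup>2 \<le> (norm u)\<^sup>2 + 1"
    using norm_triangle_ineq4[of "1 + p\<^sup>2" 1] u(2) by (simp flip: norm_power)
  moreover have "2 * norm p \<le> (norm p)\<^sup>2 + 1"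
    using sum_squares_bound[of "norm p" 1] by simp
  ultimately have *: "6 * norm p \<le> 3 * (norm u)\<^sup>2 + 6"
    by simp
  have "(4 / 5) ^ 3 * (norm u)\<^sup>2 \<le> norm u ^ 3 * (norm u)\<^sup>2"
    using u(3) by (intro mult_right_mono power_mono) auto
  then have **: "64 / 125 * (norm u)\<^sup>2 \<le> norm u ^ 5"
    using power_add[of "norm u" 3 2] by (simp add: power3_eq_cube)
  have "(4 / 5) ^ 5 \<le> norm u ^ 5"
    using u(3) by (intro power_mono) auto
  then have "1024 / 3125 \<le> norm u ^ 5"
    by (simp add: eval_nat_numeral)
  with * ** have "3 * norm p \<le> 13 * norm u ^ 5"
    by linarith
  then have "norm (- 3 * p / u ^ 5) \<le> 13"
    using u by (simp add: norm_divide norm_mult norm_power divide_le_eq)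
  then show "norm (- 3 * p / csqrt (1 + p\<^sup>2) ^ 5) \<le> 13"
    by (simp add: u_def)
qed

lemma sin_cos_strip_bound:
  assumes "z \<in> strip"
  shows "norm (sin z) \<le> 2" "norm (cos z) \<le> 2"
proof -
  have "(exp (1 / 2 :: real))\<^sup>2 \<le> 2\<^sup>2"
    using exp_le by (simp flip: exp_double)
  then have "exp (1 / 2 :: real) \<le> 2"
    by (rule power2_le_imp_le) simp
  moreover have "exp \<bar>Im z\<bar> \<le> exp (1 / 2)"
    using assms by (simp add: strip_def)
  ultimately have "exp \<bar>Im z\<bar> \<le> 2"
    by linarith
  then show "norm (sin z) \<le> 2" "norm (cos z) \<le> 2"
    using cmod_sin_le_exp[of 1 z] cmod_cos_le_exp[of 1 z] by auto
qed

lemma sin_lipschitz_strip: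
  assumes "x \<in> strip" "y \<in> strip"
  shows "norm (sin x - sin y) \<le> 2 * norm (x - y)" "norm (cos x - cos y) \<le> 2 * norm (x - y)"
proof -
  show "norm (sin x - sin y) \<le> 2 * norm (x - y)"
    by (rule field_differentiable_bound[OF convex_strip _ sin_cos_strip_bound(2) assms])
      (auto intro: has_field_derivative_at_within DERIV_sin)
  have "norm (- sin z) \<le> 2" if "z \<in> strip" for z
    using sin_cos_strip_bound(1)[OF that] by simp
  then show "norm (cos x - cos y) \<le> 2 * norm (x - y)"
    by (rule field_differentiable_bound[OF convex_strip, rotated])
      (auto intro: has_field_derivative_at_within DERIV_cos assms)
qed

lemma abs_sin_less_self:
  fixes u :: real
  assumes "u > 0"
  shows "\<bar>sin u\<bar> < u"
proof (cases "u < pi")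
  case True
  have "sin u = 2 * sin (u / 2) * cos (u / 2)"
    using sin_double[of "u / 2"] by simp
  also have "\<dots> < 2 * sin (u / 2) * 1"
    using assms True cos_monotone_0_pi[of 0 "u / 2"]
    by (intro mult_strict_left_mono) (auto intro!: sin_gt_zero)
  also have "\<dots> \<le> u"
    using sin_x_le_x[of "u / 2"] assms by simp
  finally show ?thesis
    using sin_gt_zero[OF assms True] by simp
next
  case False
  then show ?thesis
    using abs_sin_le_one[of u] pi_gt3 by linarith
qed

text \<open>The strictness matters: it makes the twist strict even for \<open>a = (pi / T)\<^sup>2\<close>.\<close>

lemma abs_sin_diff_less:
  fixes x y :: real
  assumes "x \<noteq> y"
  shows "\<bar>sin x - sin y\<bar> < \<bar>x - y\<bar>"
proof -
  have *: "\<bar>sin u\<bar> < \<bar>u\<bar>" if "u \<noteq> 0" for u :: real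
    using that abs_sin_less_self[of u] abs_sin_less_self[of "- u"] by (cases "u > 0") auto
  have "\<bar>sin ((x - y) / 2)\<bar> < \<bar>(x - y) / 2\<bar>"
    using assms by (intro *) simp
  moreover have "\<bar>sin x - sin y\<bar> \<le> 2 * \<bar>sin ((x - y) / 2)\<bar> * 1"
    unfolding sin_diff_sin abs_mult by (intro mult_mono) auto
  ultimately show ?thesis
    by (simp add: abs_divide)
qed

section \<open>Sturm comparison\<close>

lemma tendsto_quotient_at_common_zero:
  fixes d s :: "real \<Rightarrow> real"
  assumes "(d has_real_derivative D) (at c)" "(s has_real_derivative S) (at c)"
    and "d c = 0" "s c = 0" "S \<noteq> 0"
  shows "((\<lambda>t. d t / s t) \<longlongrightarrow> D / S) (at c)"
proof -
  have "((\<lambda>t. ((d t - d c) / (t - c)) / ((s t - s c) / (t - c))) \<longlongrightarrow> D / S) (at c)"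
    using assms by (intro tendsto_divide) (auto simp: has_field_derivative_iff)
  moreover have "\<forall>\<^sub>F t in at c. ((d t - d c) / (t - c)) / ((s t - s c) / (t - c)) = d t / s t"
    using assms by (auto simp: eventually_at_filter)
  ultimately show ?thesis
    by (simp add: tendsto_cong)
qed

text \<open>Comparison of \<open>d' = \<alpha> e, e' = - \<beta> d\<close> with \<open>sin (\<omega> t)\<close>. With \<open>r = \<omega> cot (\<omega> t)\<close> the function \<open>V = d e - r d\<^sup>2\<close>
  has derivative
  \<open>\<alpha> (e - r d)\<^sup>2 + (1 - \<alpha>) r\<^sup>2 d\<^sup>2 + (\<omega>\<^sup>2 - \<beta>) d\<^sup>2 \<ge> 0\<close>.
  If \<open>d\<close> vanishes at both ends, then so does \<open>V\<close> in the limit. Hence \<open>V\<close> is constantly \<open>0\<close> and each summand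
  of its derivative vanishes.\<close>

lemma sturm_rigidity:
  fixes d e \<alpha> \<beta> :: "real \<Rightarrow> real" and T :: real
  defines "\<omega> \<equiv> pi / T"
  assumes "T > 0"
    and d: "\<And>t. 0 \<le> t \<Longrightarrow> t \<le> T \<Longrightarrow> (d has_real_derivative \<alpha> t * e t) (at t)"
    and e: "\<And>t. 0 \<le> t \<Longrightarrow> t \<le> T \<Longrightarrow> (e has_real_derivative - \<beta> t * d t) (at t)"
    and \<alpha>: "\<And>t. 0 < t \<Longrightarrow> t < T \<Longrightarrow> 0 \<le> \<alpha> t \<and> \<alpha> t \<le> 1"
    and \<beta>: "\<And>t. 0 < t \<Longrightarrow> t < T \<Longrightarrow> \<beta> t \<le> \<omega>\<^sup>2"
    and "d 0 = 0" "d T = 0" and t: "0 < t" "t < T" and "d t \<noteq> 0"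
  shows "\<beta> t = \<omega>\<^sup>2" and "\<alpha> t = 1 \<or> cos (\<omega> * t) = 0"
proof -
  have "\<omega> > 0"
    using \<open>T > 0\<close> by (simp add: \<omega>_def)
  have s: "sin (\<omega> * x) > 0" if "0 < x" "x < T" for x
    using that \<open>T > 0\<close> by (intro sin_gt_zero) (auto simp: \<omega>_def field_simps)
  define V where "V x = d x * e x - \<omega> * cos (\<omega> * x) * (d x * (d x / sin (\<omega> * x)))" for x
  define r where "r x = \<omega> * cos (\<omega> * x) / sin (\<omega> * x)" for x
  define V' where "V' x = \<alpha> x * (e x - r x * d x)\<^sup>2 + (1 - \<alpha> x) * (r x)\<^sup>2 * (d x)\<^sup>2
    + (\<omega>\<^sup>2 - \<beta> x) * (d x)\<^sup>2" for x
  have der: "(V has_real_derivative V' x) (at x)" if x: "0 < x" "x < T" for x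
  proof -
    have r2: "\<omega>\<^sup>2 / (sin (\<omega> * x))\<^sup>2 = \<omega>\<^sup>2 + (r x)\<^sup>2"
    proof -
      have "\<omega>\<^sup>2 + (r x)\<^sup>2 = \<omega>\<^sup>2 * ((sin (\<omega> * x))\<^sup>2 + (cos (\<omega> * x))\<^sup>2) / (sin (\<omega> * x))\<^sup>2"
        using s[OF x] by (simp del: sin_cos_squared_add sin_cos_squared_add2
          add: r_def power_divide power_mult_distrib add_divide_distrib distrib_left)
      then show ?thesis
        by simp
    qed
    have "((\<lambda>x. r x) has_real_derivative - (\<omega>\<^sup>2 / (sin (\<omega> * x))\<^sup>2)) (at x)"
    proof -
      have "((\<lambda>x. r x) has_real_derivative
          ((- \<omega> * sin (\<omega> * x) * \<omega>) * sin (\<omega> * x) - \<omega> * cos (\<omega> * x) * (cos (\<omega> * x) * \<omega>)) /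
            (sin (\<omega> * x) * sin (\<omega> * x))) (at x)"
        unfolding r_def using s[OF x] by (auto intro!: derivative_eq_intros)
      also have "(- \<omega> * sin (\<omega> * x) * \<omega>) * sin (\<omega> * x) - \<omega> * cos (\<omega> * x) * (cos (\<omega> * x) * \<omega>) =
          - (\<omega>\<^sup>2 * ((sin (\<omega> * x))\<^sup>2 + (cos (\<omega> * x))\<^sup>2))"
        unfolding power2_eq_square by (simp only: algebra_simps)
      finally show ?thesis
        by (simp flip: power2_eq_square)
    qed
    then have "((\<lambda>x. d x * e x - r x * (d x * d x)) has_real_derivative
        (d x * (- \<beta> x * d x) + \<alpha> x * e x * e x) -
        (r x * (d x * (\<alpha> x * e x) + \<alpha> x * e x * d x) + - (\<omega>\<^sup>2 / (sin (\<omega> * x))\<^sup>2) * (d x * d x))) (at x)"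
      using x by (intro DERIV_diff DERIV_mult' d e) auto
    also have "(\<lambda>x. d x * e x - r x * (d x * d x)) = V"
      by (simp add: V_def r_def fun_eq_iff)
    also have "(d x * (- \<beta> x * d x) + \<alpha> x * e x * e x) -
        (r x * (d x * (\<alpha> x * e x) + \<alpha> x * e x * d x) + - (\<omega>\<^sup>2 / (sin (\<omega> * x))\<^sup>2) * (d x * d x)) = V' x"
      unfolding r2 V'_def by (simp add: power2_eq_square algebra_simps)
    finally show ?thesis .
  qed
  have V': "V' x \<ge> 0" if "0 < x" "x < T" for x
    unfolding V'_def using \<alpha>[OF that] \<beta>[OF that]
    by (intro add_nonneg_nonneg mult_nonneg_nonneg) auto
  \<comment> \<open>\<open>d / sin (\<omega> t)\<close> has a finite limit at both ends, where numerator and denominator vanish.\<close>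
  have lim: "(V \<longlongrightarrow> 0) (at c)" if c: "c \<in> {0, T}" for c
  proof -
    have c': "0 \<le> c" "c \<le> T" "d c = 0" "sin (\<omega> * c) = 0" "cos (\<omega> * c) \<noteq> 0"
      using c \<open>T > 0\<close> \<open>d 0 = 0\<close> \<open>d T = 0\<close> by (auto simp: \<omega>_def)
    have "((\<lambda>x. d x / sin (\<omega> * x)) \<longlongrightarrow> \<alpha> c * e c / (\<omega> * cos (\<omega> * c))) (at c)"
      using c' \<open>\<omega> > 0\<close>
      by (intro tendsto_quotient_at_common_zero d) (auto intro!: derivative_eq_intros)
    note q = this
    have "(d \<longlongrightarrow> 0) (at c)" "(e \<longlongrightarrow> e c) (at c)"
      using DERIV_isCont[OF d[OF c'(1,2)]] DERIV_isCont[OF e[OF c'(1,2)]] c'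
      by (auto simp: isCont_def)
    then have "(V \<longlongrightarrow> 0 * e c - \<omega> * cos (\<omega> * c) *
        (0 * (\<alpha> c * e c / (\<omega> * cos (\<omega> * c))))) (at c)"
      unfolding V_def
      by (intro q tendsto_diff tendsto_mult tendsto_cos tendsto_const tendsto_ident_at)
    then show ?thesis
      by simp
  qed
  have mono: "V x \<le> V y" if "0 < x" "x \<le> y" "y < T" for x y
  proof (rule DERIV_nonneg_imp_nondecreasing[OF that(2)])
    fix z assume "x \<le> z" "z \<le> y"
    then show "\<exists>l. (V has_real_derivative l) (at z) \<and> 0 \<le> l"
      using that der[of z] V'[of z] by (intro exI[of _ "V' z"]) auto
  qed
  have V0: "V x = 0" if x: "0 < x" "x < T" for x
  proof (rule antisym)
    have "(V \<longlongrightarrow> 0) (at_left T)" "(V \<longlongrightarrow> 0) (at_right 0)"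
      using lim filterlim_at_split by blast+
    moreover have "\<forall>\<^sub>F y in at_left T. V x \<le> V y"
      using eventually_at_left[of x T] x mono by auto
    moreover have "\<forall>\<^sub>F y in at_right 0. V y \<le> V x"
      using eventually_at_right[of 0 x] x mono by auto
    ultimately show "V x \<le> 0" "0 \<le> V x"
      by (auto intro: tendsto_lowerbound tendsto_upperbound)
  qed
  have "(V has_real_derivative 0) (at t)"
    by (rule has_field_derivative_transform_within_open[of "\<lambda>_. 0" _ _ "{0<..<T}"])
      (use t V0 in auto)
  then have "V' t = 0"
    using der[OF t] DERIV_unique by blast
  moreover have "0 \<le> \<alpha> t * (e t - r t * d t)\<^sup>2" "0 \<le> (1 - \<alpha> t) * (r t)\<^sup>2 * (d t)\<^sup>2"
    "0 \<le> (\<omega>\<^sup>2 - \<beta> t) * (d t)\<^sup>2"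
    using \<alpha>[OF t] \<beta>[OF t] by auto
  ultimately have "(1 - \<alpha> t) * (r t)\<^sup>2 * (d t)\<^sup>2 = 0" "(\<omega>\<^sup>2 - \<beta> t) * (d t)\<^sup>2 = 0"
    unfolding V'_def by linarith+
  then show "\<beta> t = \<omega>\<^sup>2" "\<alpha> t = 1 \<or> cos (\<omega> * t) = 0"
    using \<open>d t \<noteq> 0\<close> \<open>\<omega> > 0\<close> s[OF t] by (auto simp: r_def)
qed

text \<open>If \<open>d\<close> is not positive at time \<open>T\<close>, it has a first zero \<open>x \<le> T\<close>. Rigidity on \<open>{0..x}\<close> forces
  \<open>\<beta> = (pi / x)\<^sup>2\<close>, and then \<open>\<beta> \<le> (pi / T)\<^sup>2\<close> forces \<open>x = T\<close>.\<close>

lemma sturm_positive_or_rigid: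
  fixes d e \<alpha> \<beta> :: "real \<Rightarrow> real" and T :: real
  assumes "T > 0"
    and d: "\<And>t. (d has_real_derivative \<alpha> t * e t) (at t)"
    and e: "\<And>t. (e has_real_derivative - \<beta> t * d t) (at t)"
    and \<alpha>: "\<And>t. 0 \<le> \<alpha> t \<and> \<alpha> t \<le> 1"
    and \<beta>: "\<And>t. \<beta> t \<le> (pi / T)\<^sup>2"
    and init: "d 0 = 0" "e 0 > 0" "\<alpha> 0 > 0"
    and "d T \<le> 0" and t: "0 < t" "t < T"
  shows "d t > 0" and "\<beta> t = (pi / T)\<^sup>2" and "\<alpha> t = 1 \<or> cos (pi / T * t) = 0"
proof -
  have cont: "continuous_on A d" for A
    using d by (meson DERIV_isCont continuous_at_imp_continuous_on)
  obtain \<delta> where \<delta>: "\<delta> > 0" "\<And>h. 0 < h \<Longrightarrow> h < \<delta> \<Longrightarrow> 0 < d h"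
    using DERIV_pos_inc_right[OF d[of 0]] init by auto
  have "\<delta> \<le> T"
    using \<delta>(2)[of T] \<open>d T \<le> 0\<close> \<open>T > 0\<close> by linarith
  define Z where "Z = {\<delta>/2..T} \<inter> d -` {0}"
  have pos: "0 < d (\<delta>/2)"
    using \<delta> by simp
  have "\<exists>x\<ge>\<delta>/2. x \<le> T \<and> d x = 0"
    using \<open>d T \<le> 0\<close> \<delta>(1) \<open>\<delta> \<le> T\<close> less_imp_le[OF pos] by (intro IVT2' cont) auto
  then have "Z \<noteq> {}"
    by (auto simp: Z_def)
  moreover have "compact Z"
    unfolding Z_def
    by (intro compact_Int_closed closed_vimage cont) auto
  ultimately have "\<exists>x\<in>Z. \<forall>y\<in>Z. x \<le> y"
    by (intro compact_attains_inf)
  then obtain x where x: "x \<in> Z" "\<And>y. y \<in> Z \<Longrightarrow> x \<le> y"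
    by blast
  have "\<delta>/2 \<le> x" and x1: "x \<le> T" "d x = 0"
    using x(1) by (auto simp: Z_def)
  moreover have "x \<noteq> \<delta>/2"
    using pos \<open>d x = 0\<close> by auto
  ultimately have x2: "\<delta>/2 < x"
    by simp
  then have "x > 0"
    using \<open>\<delta> > 0\<close> by simp
  note x' = this x1 x2
  have dpos: "d y > 0" if y: "0 < y" "y < x" for y
  proof (cases "y < \<delta>")
    case False
    show ?thesis
    proof (rule ccontr)
      assume "\<not> 0 < d y"
      then have "\<exists>z\<ge>\<delta>/2. z \<le> y \<and> d z = 0"
        using False \<delta>(1) less_imp_le[OF pos] by (intro IVT2' cont) auto
      then show False
        using x y x' by (force simp: Z_def)
    qed
  qed (use \<delta> y in auto)
  have le: "(pi / T)\<^sup>2 \<le> (pi / x)\<^sup>2"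
    using x' by (intro power_mono divide_left_mono) auto
  have rigid: "\<beta> y = (pi / x)\<^sup>2" "\<alpha> y = 1 \<or> cos (pi / x * y) = 0" if "0 < y" "y < x" for y
    using sturm_rigidity[of x d \<alpha> e \<beta> y] d e \<alpha> order_trans[OF \<beta> le] x' init dpos[OF that] that
    by auto
  have "(pi / x)\<^sup>2 \<le> (pi / T)\<^sup>2"
    using rigid(1)[of "x/2"] \<beta>[of "x/2"] x' by simp
  moreover have "(pi / T)\<^sup>2 < (pi / x)\<^sup>2" if "x < T"
    using that x' \<open>T > 0\<close> by (intro power_strict_mono divide_strict_left_mono) auto
  ultimately have "x = T"
    using x' by linarith
  then show "d t > 0" "\<beta> t = (pi / T)\<^sup>2" "\<alpha> t = 1 \<or> cos (pi / T * t) = 0"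
    using rigid dpos t by auto
qed

section \<open>Zeros along a holomorphic implicit curve\<close>

text \<open>\<open>A\<close> and \<open>B\<close> are the complex partial derivatives of \<open>G\<close>. The quadratic bound compares two points near the
  base point; it contains differentiability at every point and Lipschitz continuity of the derivative.\<close>

definition strictly_differentiable_on ::
  "(complex \<times> complex \<Rightarrow> complex) \<Rightarrow> (complex \<times> complex \<Rightarrow> complex) \<Rightarrow>
   (complex \<times> complex \<Rightarrow> complex) \<Rightarrow> (complex \<times> complex) set \<Rightarrow> bool" where
  "strictly_differentiable_on G A B \<Omega> \<longleftrightarrow>
     (\<exists>C\<ge>0. \<forall>z\<^sub>0\<in>\<Omega>. \<forall>z\<^sub>1\<in>\<Omega>. \<forall>z\<^sub>2\<in>\<Omega>.
        norm (G z\<^sub>1 - G z\<^sub>2 - (A z\<^sub>0 * (fst z\<^sub>1 - fst z\<^sub>2) + B z\<^sub>0 * (snd z\<^sub>1 - snd z\<^sub>2)))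
          \<le> C * (norm (z\<^sub>1 - z\<^sub>0) + norm (z\<^sub>2 - z\<^sub>0)) * norm (z\<^sub>1 - z\<^sub>2))"

lemma strictly_differentiable_on_diff:
  assumes "strictly_differentiable_on G A B \<Omega>"
  shows "strictly_differentiable_on (\<lambda>z. G z - (\<alpha> * fst z + \<beta> * snd z + \<gamma>)) (\<lambda>z. A z - \<alpha>) (\<lambda>z. B z - \<beta>) \<Omega>"
proof -
  have eq: "G z\<^sub>1 - (\<alpha> * fst z\<^sub>1 + \<beta> * snd z\<^sub>1 + \<gamma>) - (G z\<^sub>2 - (\<alpha> * fst z\<^sub>2 + \<beta> * snd z\<^sub>2 + \<gamma>)) -
      ((A z\<^sub>0 - \<alpha>) * (fst z\<^sub>1 - fst z\<^sub>2) + (B z\<^sub>0 - \<beta>) * (snd z\<^sub>1 - snd z\<^sub>2)) =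
      G z\<^sub>1 - G z\<^sub>2 - (A z\<^sub>0 * (fst z\<^sub>1 - fst z\<^sub>2) + B z\<^sub>0 * (snd z\<^sub>1 - snd z\<^sub>2))" for z\<^sub>0 z\<^sub>1 z\<^sub>2
    by (simp add: algebra_simps)
  then show ?thesis
    using assms by (simp only: strictly_differentiable_on_def eq)
qed

lemma strictly_differentiable_on_has_derivative:
  assumes "strictly_differentiable_on G A B \<Omega>" "open \<Omega>" "z \<in> \<Omega>"
  shows "(G has_derivative (\<lambda>h. A z * fst h + B z * snd h)) (at z)"
proof -
  obtain C where C: "C \<ge> 0" "\<And>w. w \<in> \<Omega> \<Longrightarrow>
      norm (G w - G z - (A z * (fst w - fst z) + B z * (snd w - snd z)))
        \<le> C * (norm (w - z) + norm (z - z)) * norm (w - z)"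
    using assms unfolding strictly_differentiable_on_def by metis
  show ?thesis
  proof (rule has_derivativeI_sandwich[where e = 1])
    show "bounded_linear (\<lambda>h. A z * fst h + B z * snd h)"
      by (intro bounded_linear_intros)
    show "((\<lambda>w. if w \<in> \<Omega> then C * norm (w - z) else norm (G w - G z - (A z * fst (w - z) + B z * snd (w - z))) / norm (w - z)) \<longlongrightarrow> 0) (at z)"
    proof -
      have "((\<lambda>w. C * norm (w - z)) \<longlongrightarrow> C * norm (z - z)) (at z)"
        by (intro tendsto_intros)
      moreover have "\<forall>\<^sub>F w in at z. w \<in> \<Omega>"
        using assms by (intro eventually_at_in_open') auto
      ultimately show ?thesis
        by (auto elim!: Lim_transform_eventually elim: eventually_mono)
    qed
    show "norm (G w - G z - (A z * fst (w - z) + B z * snd (w - z))) / norm (w - z)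
        \<le> (if w \<in> \<Omega> then C * norm (w - z) else norm (G w - G z - (A z * fst (w - z) + B z * snd (w - z))) / norm (w - z))"
      if "w \<noteq> z" for w
      using that C(2)[of w] by (auto simp: divide_le_eq)
  qed auto
qed

text \<open>On a ball in which \<open>B\<close> stays close to \<open>B (s, p)\<close> the map \<open>\<Phi> (q, w) = (q, G (q, w))\<close> is injective, so invariance
  of domain makes its image open and its inverse continuous. The inverse is differentiable with the inverse
  derivative, which is complex linear; \<open>\<phi>\<close> is read off on the slice \<open>(\<zeta>, 0)\<close>. Uniqueness in the ball is what allows
  \<open>\<phi>\<close> to be matched with a real solution curve.\<close>

lemma holomorphic_implicit_function:
  assumes strict: "strictly_differentiable_on G A B \<Omega>" and "open \<Omega>"
    and z0: "(s, p) \<in> \<Omega>" "G (s, p) = 0" "B (s, p) \<noteq> 0"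
  obtains \<phi> \<phi>' r \<delta> where "r > 0" "\<delta> > 0"
    and "\<And>\<zeta>. \<zeta> \<in> ball s r \<Longrightarrow> (\<zeta>, \<phi> \<zeta>) \<in> \<Omega> \<and> (\<phi> has_field_derivative \<phi>' \<zeta>) (at \<zeta>)"
    and "\<And>\<zeta> w. \<zeta> \<in> ball s r \<Longrightarrow> (\<zeta>, w) \<in> ball (s, p) \<delta> \<Longrightarrow> G (\<zeta>, w) = 0 \<Longrightarrow> w = \<phi> \<zeta>"
proof -
  obtain C where "C \<ge> 0" and C: "\<And>z\<^sub>0 z\<^sub>1 z\<^sub>2. z\<^sub>0 \<in> \<Omega> \<Longrightarrow> z\<^sub>1 \<in> \<Omega> \<Longrightarrow> z\<^sub>2 \<in> \<Omega> \<Longrightarrow>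
      norm (G z\<^sub>1 - G z\<^sub>2 - (A z\<^sub>0 * (fst z\<^sub>1 - fst z\<^sub>2) + B z\<^sub>0 * (snd z\<^sub>1 - snd z\<^sub>2)))
        \<le> C * (norm (z\<^sub>1 - z\<^sub>0) + norm (z\<^sub>2 - z\<^sub>0)) * norm (z\<^sub>1 - z\<^sub>2)"
    using strict unfolding strictly_differentiable_on_def by metis
  let ?z = "(s, p)" let ?b = "norm (B (s, p))"
  obtain \<epsilon> where \<epsilon>: "\<epsilon> > 0" "ball ?z \<epsilon> \<subseteq> \<Omega>"
    using \<open>open \<Omega>\<close> z0 openE by blast
  define \<delta> where "\<delta> = min \<epsilon> (?b / (3 * C + 1))"
  have "\<delta> > 0"
    using \<epsilon> z0 \<open>C \<ge> 0\<close> by (auto simp: \<delta>_def)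
  have "\<delta> * (3 * C + 1) \<le> ?b"
    using \<open>C \<ge> 0\<close> pos_le_divide_eq[of "3 * C + 1" \<delta> ?b] by (simp add: \<delta>_def)
  then have small: "3 * C * \<delta> < ?b"
    using \<open>\<delta> > 0\<close> by (simp add: algebra_simps)
  define S where "S = ball ?z \<delta>"
  have S: "open S" "S \<subseteq> \<Omega>" "?z \<in> S"
    using \<epsilon> \<open>\<delta> > 0\<close> by (auto simp: S_def \<delta>_def)
  have near: "norm (z - ?z) < \<delta>" if "z \<in> S" for z
    using that by (simp add: S_def dist_norm norm_minus_commute)
  have vert: "norm (G (q, x) - G (q, y) - B ?z * (x - y)) \<le> 2 * C * \<delta> * norm (x - y)"
    if "(q, x) \<in> S" "(q, y) \<in> S" for q x y
  proof -
    have "norm (G (q, x) - G (q, y) - B ?z * (x - y)) \<le>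
        C * (norm ((q, x) - ?z) + norm ((q, y) - ?z)) * norm (x - y)"
      using C[of ?z "(q, x)" "(q, y)"] that S by auto
    also have "\<dots> \<le> C * (\<delta> + \<delta>) * norm (x - y)"
      using near[OF that(1)] near[OF that(2)] \<open>C \<ge> 0\<close>
      by (intro mult_right_mono mult_left_mono add_mono) auto
    finally show ?thesis
      by simp
  qed
  \<comment> \<open>Strict differentiability at \<open>z\<close> and at the centre, applied to the same vertical increment,
    compares \<open>B z\<close> with \<open>B (s, p)\<close>.\<close>
  have Bz: "B z \<noteq> 0" if z: "z \<in> S" for z
  proof
    assume "B z = 0"
    obtain \<eta> where \<eta>: "\<eta> > 0" "ball z \<eta> \<subseteq> S"
      using S z openE by blast
    define k where "k = min (\<eta> / 2) \<delta>"
    have k: "k > 0" "k < \<eta>" "k \<le> \<delta>"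
      using \<eta> \<open>\<delta> > 0\<close> by (auto simp: k_def)
    define w where "w = (fst z, snd z + complex_of_real k)"
    have wz: "norm (w - z) = k"
      using k by (cases z) (simp add: w_def norm_Pair)
    then have w: "w \<in> S"
      using k \<eta> by (auto intro!: subsetD[OF \<eta>(2)] simp: dist_norm norm_minus_commute)
    have "norm (G w - G z) \<le> C * k * k"
      using C[of z w z] \<open>B z = 0\<close> w z S wz by (auto simp: w_def)
    also have "C * k * k \<le> C * \<delta> * k"
      using k \<open>C \<ge> 0\<close> by (intro mult_right_mono mult_left_mono) auto
    finally have "norm (G w - G z) \<le> C * \<delta> * k" .
    moreover have "norm (G w - G z - B ?z * of_real k) \<le> 2 * C * \<delta> * k"
      using vert[of "fst z" "snd z + of_real k" "snd z"] w z k by (simp add: w_def)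
    ultimately have "norm (B ?z * of_real k) \<le> C * \<delta> * k + 2 * C * \<delta> * k"
      using norm_triangle_sub[of "B ?z * of_real k" "G w - G z"]
      by (simp add: norm_minus_commute)
    then have "?b * k \<le> 3 * C * \<delta> * k"
      using k by (simp add: norm_mult)
    then show False
      using small k by simp
  qed
  define \<Phi> where "\<Phi> z = (fst z, G z)" for z
  have derG: "(G has_derivative (\<lambda>h. A z * fst h + B z * snd h)) (at z)" if "z \<in> S" for z
    using strictly_differentiable_on_has_derivative[OF strict \<open>open \<Omega>\<close> subsetD[OF S(2) that]] .
  have der\<Phi>: "(\<Phi> has_derivative (\<lambda>h. (fst h, A z * fst h + B z * snd h))) (at z)" if "z \<in> S" for z
    unfolding \<Phi>_def by (rule has_derivative_Pair[OF has_derivative_fst[OF has_derivative_ident] derG[OF that]])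
  have cont: "continuous_on S \<Phi>"
    by (intro continuous_at_imp_continuous_on ballI has_derivative_continuous[OF der\<Phi>])
  have inj: "inj_on \<Phi> S"
  proof (rule inj_onI)
    fix z w assume zw: "z \<in> S" "w \<in> S" "\<Phi> z = \<Phi> w"
    obtain q x y where [simp]: "z = (q, x)" "w = (q, y)"
      using zw(3) by (cases z, cases w) (auto simp: \<Phi>_def)
    have "?b * norm (x - y) \<le> 2 * C * \<delta> * norm (x - y)"
      using vert[of q x y] zw by (simp add: \<Phi>_def norm_mult)
    moreover have "2 * C * \<delta> < ?b"
      using small \<open>\<delta> > 0\<close> \<open>C \<ge> 0\<close> mult_nonneg_nonneg[of C \<delta>] by linarith
    then have "2 * C * \<delta> * norm (x - y) < ?b * norm (x - y)" if "x \<noteq> y"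
      using that by (intro mult_strict_right_mono) auto
    ultimately have "x = y"
      by linarith
    then show "z = w"
      by simp
  qed
  obtain \<Psi> where \<Psi>: "homeomorphism S (\<Phi> ` S) \<Phi> \<Psi>"
    using invariance_of_domain_homeomorphism[OF S(1) cont _ inj] by auto
  have "open (\<Phi> ` S)"
    by (rule invariance_of_domain[OF cont S(1) inj])
  moreover have "(s, 0) \<in> \<Phi> ` S"
    using S(3) z0(2) by (auto simp: \<Phi>_def intro!: image_eqI[of _ _ ?z])
  ultimately obtain r where r: "r > 0" "ball (s, 0) r \<subseteq> \<Phi> ` S"
    using openE by blast
  define \<phi> where "\<phi> \<zeta> = snd (\<Psi> (\<zeta>, 0))" for \<zeta>
  show ?thesis
  proof (rule that[of r \<delta> \<phi> "\<lambda>\<zeta>. - A (\<zeta>, \<phi> \<zeta>) / B (\<zeta>, \<phi> \<zeta>)"])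
    fix \<zeta> assume \<zeta>: "\<zeta> \<in> ball s r"
    then have img: "(\<zeta>, 0) \<in> \<Phi> ` S"
      using r(2) by (auto simp: dist_Pair_Pair)
    then have \<Psi>\<zeta>: "\<Psi> (\<zeta>, 0) \<in> S" "\<Phi> (\<Psi> (\<zeta>, 0)) = (\<zeta>, 0)"
      using \<Psi> unfolding homeomorphism_def by auto
    have eq: "\<Psi> (\<zeta>, 0) = (\<zeta>, \<phi> \<zeta>)"
      using \<Psi>\<zeta>(2) by (simp add: \<Phi>_def \<phi>_def prod_eq_iff)
    let ?A = "A (\<zeta>, \<phi> \<zeta>)" let ?B = "B (\<zeta>, \<phi> \<zeta>)"
    have "?B \<noteq> 0"
      using Bz \<Psi>\<zeta>(1) eq by simp
    have "(\<Psi> has_derivative (\<lambda>h. (fst h, (snd h - ?A * fst h) / ?B))) (at (\<zeta>, 0))"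
    proof (rule has_derivative_inverse_basic[where T = "\<Phi> ` S" and f = \<Phi>])
      show "(\<Phi> has_derivative (\<lambda>h. (fst h, ?A * fst h + ?B * snd h))) (at (\<Psi> (\<zeta>, 0)))"
        using der\<Phi>[OF \<Psi>\<zeta>(1)] by (simp add: eq)
      show "bounded_linear (\<lambda>h. (fst h, (snd h - ?A * fst h) / ?B))"
        by (intro bounded_linear_Pair bounded_linear_intros bounded_linear_divide
            bounded_linear_compose[OF bounded_linear_divide])
      show "(\<lambda>h. (fst h, (snd h - ?A * fst h) / ?B)) \<circ> (\<lambda>h. (fst h, ?A * fst h + ?B * snd h)) = id"
        using \<open>?B \<noteq> 0\<close> by (auto simp: fun_eq_iff)
      show "continuous (at (\<zeta>, 0)) \<Psi>"
        using homeomorphism_cont2[OF \<Psi>] img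
        unfolding continuous_on_eq_continuous_at[OF \<open>open (\<Phi> ` S)\<close>] by blast
      show "\<Phi> (\<Psi> z) = z" if "z \<in> \<Phi> ` S" for z
        by (rule homeomorphism_apply2[OF \<Psi> that])
    qed (use \<open>open (\<Phi> ` S)\<close> img in auto)
    then have "((\<lambda>\<zeta>. snd (\<Psi> (\<zeta>, 0))) has_derivative (\<lambda>h. snd (fst (h, 0::complex), (snd (h, 0) - ?A * fst (h, 0::complex)) / ?B))) (at \<zeta>)"
      by (intro has_derivative_snd has_derivative_compose[where g = \<Psi> and f = "\<lambda>\<zeta>. (\<zeta>, 0)"]
          has_derivative_Pair has_derivative_ident has_derivative_const)
    then have "(\<phi> has_field_derivative - ?A / ?B) (at \<zeta>)"
      unfolding has_field_derivative_def \<phi>_def[symmetric]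
      by (rule has_derivative_eq_rhs) (auto simp: fun_eq_iff)
    then show "(\<zeta>, \<phi> \<zeta>) \<in> \<Omega> \<and> (\<phi> has_field_derivative - ?A / ?B) (at \<zeta>)"
      using \<Psi>\<zeta> S eq by auto
    fix w assume w: "(\<zeta>, w) \<in> ball ?z \<delta>" "G (\<zeta>, w) = 0"
    then have "\<Phi> (\<zeta>, w) = \<Phi> (\<Psi> (\<zeta>, 0))"
      using \<Psi>\<zeta> by (simp add: \<Phi>_def)
    then have "(\<zeta>, w) = \<Psi> (\<zeta>, 0)"
      using inj_onD[OF inj] w(1) \<Psi>\<zeta>(1) by (simp add: S_def)
    then show "w = \<phi> \<zeta>"
      using eq by simp
  qed (rule r(1), rule \<open>\<delta> > 0\<close>)
qed

text \<open>Near \<open>s\<close> the continuous real curve \<open>\<phi>\<close> coincides with the holomorphic implicit function \<open>\<psi>\<close>, so \<open>H\<close> along the curve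
  is the restriction of a holomorphic function of one variable. A limit point of its real zeros makes it
  vanish identically.\<close>

lemma holomorphic_zero_set_locally_full:
  assumes G: "strictly_differentiable_on G A B \<Omega>" and H: "strictly_differentiable_on H A' B' \<Omega>"
    and "open \<Omega>" and z0: "(of_real s, of_real (\<phi> s)) \<in> \<Omega>" "B (of_real s, of_real (\<phi> s)) \<noteq> 0"
    and \<phi>: "isCont \<phi> s" "\<And>x. G (of_real x, of_real (\<phi> x)) = 0"
    and lim: "s islimpt {x. H (of_real x, of_real (\<phi> x)) = 0}"
  shows "\<forall>\<^sub>F x in nhds s. H (of_real x, of_real (\<phi> x)) = 0"
proof -
  obtain \<psi> \<psi>' r \<delta> where r: "r > 0" "\<delta> > 0"
    and \<psi>: "\<And>\<zeta>. \<zeta> \<in> ball (of_real s) r \<Longrightarrow> (\<zeta>, \<psi> \<zeta>) \<in> \<Omega> \<and> (\<psi> has_field_derivative \<psi>' \<zeta>) (at \<zeta>)"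
    and uniq: "\<And>\<zeta> w. \<zeta> \<in> ball (of_real s) r \<Longrightarrow> (\<zeta>, w) \<in> ball (of_real s, of_real (\<phi> s)) \<delta> \<Longrightarrow>
      G (\<zeta>, w) = 0 \<Longrightarrow> w = \<psi> \<zeta>"
    by (rule holomorphic_implicit_function[OF G \<open>open \<Omega>\<close> z0(1) \<phi>(2) z0(2)]) (rule that; assumption)
  let ?D = "ball (complex_of_real s) r"
  have "((\<lambda>\<zeta>. H (\<zeta>, \<psi> \<zeta>)) has_field_derivative (A' (\<zeta>, \<psi> \<zeta>) + B' (\<zeta>, \<psi> \<zeta>) * \<psi>' \<zeta>)) (at \<zeta>)"
    if \<zeta>: "\<zeta> \<in> ?D" for \<zeta>
  proof -
    have "((\<lambda>\<zeta>. (\<zeta>, \<psi> \<zeta>)) has_derivative (\<lambda>h. (h, \<psi>' \<zeta> * h))) (at \<zeta>)"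
      using \<psi>[OF \<zeta>] unfolding has_field_derivative_def
      by (intro has_derivative_Pair has_derivative_ident) auto
    from has_derivative_compose[OF this
        strictly_differentiable_on_has_derivative[OF H \<open>open \<Omega>\<close> conjunct1[OF \<psi>[OF \<zeta>]]]]
    show ?thesis
      unfolding has_field_derivative_def
      by (rule has_derivative_eq_rhs) (auto simp: fun_eq_iff algebra_simps)
  qed
  then have holo: "(\<lambda>\<zeta>. H (\<zeta>, \<psi> \<zeta>)) holomorphic_on ?D"
    unfolding holomorphic_on_open[OF open_ball] by blast
  have "((\<lambda>x. (complex_of_real x, complex_of_real (\<phi> x))) \<longlongrightarrow> (of_real s, of_real (\<phi> s))) (nhds s)"
    using \<phi>(1) filterlim_ident[of "nhds s"]
    by (intro tendsto_intros) (auto simp: isCont_def tendsto_at_iff_tendsto_nhds)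
  then have "\<forall>\<^sub>F x in nhds s. (complex_of_real x, complex_of_real (\<phi> x)) \<in> ball (of_real s, of_real (\<phi> s)) \<delta>"
    using r by (auto simp: tendsto_iff dist_commute)
  moreover have "\<forall>\<^sub>F x in nhds s. complex_of_real x \<in> ?D"
    using eventually_nhds_in_open[of "ball s r" s] r
    by (auto simp: dist_norm elim!: eventually_mono simp flip: of_real_diff)
  ultimately have ev: "\<forall>\<^sub>F x in nhds s. complex_of_real x \<in> ?D \<and> of_real (\<phi> x) = \<psi> (of_real x)"
    by eventually_elim (use uniq \<phi>(2) in blast)
  define U where "U = {\<zeta> \<in> ?D. H (\<zeta>, \<psi> \<zeta>) = 0}"
  have "complex_of_real s islimpt U"
    unfolding islimpt_iff_eventually
  proof
    assume "\<forall>\<^sub>F \<zeta> in at (complex_of_real s). \<zeta> \<notin> U"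
    moreover have "filterlim complex_of_real (at (complex_of_real s)) (at s)"
      by (auto simp: filterlim_at eventually_at_filter intro!: tendsto_intros)
    ultimately have "\<forall>\<^sub>F x in at s. complex_of_real x \<notin> U"
      by (rule eventually_compose_filterlim)
    then have "\<forall>\<^sub>F x in at s. x \<notin> {x. H (of_real x, of_real (\<phi> x)) = 0}"
      using conjunct1[OF ev[unfolded eventually_nhds_conv_at]]
      by eventually_elim (auto simp: U_def)
    then show False
      using lim by (simp add: islimpt_iff_eventually)
  qed
  have zero: "H (\<zeta>, \<psi> \<zeta>) = 0" if "\<zeta> \<in> ?D" for \<zeta>
    by (rule analytic_continuation[OF holo _ _ _ _ \<open>complex_of_real s islimpt U\<close> _ that])
      (use r in \<open>auto simp: U_def\<close>)
  show ?thesis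
    using ev by eventually_elim (use zero in auto)
qed

section \<open>Instability of a curve of fixed points\<close>

lemma funpow_image_disjoint:
  assumes "inj Q" and "\<And>n. n > 0 \<Longrightarrow> (Q ^^ n) ` U \<inter> U = {}" and "i < j"
  shows "(Q ^^ i) ` U \<inter> (Q ^^ j) ` U = {}"
proof -
  have "(Q ^^ j) ` U = (Q ^^ i) ` (Q ^^ (j - i)) ` U"
    using \<open>i < j\<close> by (simp add: image_image flip: o_apply[of "Q ^^ i"] funpow_add)
  moreover have "(Q ^^ i) ` U \<inter> (Q ^^ i) ` ((Q ^^ (j - i)) ` U) = (Q ^^ i) ` (U \<inter> (Q ^^ (j - i)) ` U)"
    using image_Int[OF inj_fn[OF \<open>inj Q\<close>]] by metis
  ultimately show ?thesis
    using assms(2)[of "j - i"] \<open>i < j\<close> by auto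
qed

text \<open>Otherwise the iterates of \<open>U\<close> are pairwise disjoint sets of the same positive measure inside a bounded set.\<close>

lemma no_bounded_wandering_set_vec:
  fixes Q :: "real^2 \<Rightarrow> real^2"
  assumes "inj Q" and der: "\<And>x. (Q has_derivative Q' x) (at x)"
    and det: "\<And>x. det (matrix (Q' x)) = 1"
    and U: "open U" "U \<noteq> {}" and V: "bounded V" "\<And>n. (Q ^^ n) ` U \<subseteq> V"
  shows "\<exists>n>0. (Q ^^ n) ` U \<inter> U \<noteq> {}"
proof (rule ccontr)
  assume "\<not> ?thesis"
  then have disj: "(Q ^^ i) ` U \<inter> (Q ^^ j) ` U = {}" if "i < j" for i j
    using funpow_image_disjoint[OF \<open>inj Q\<close> _ that] by blast
  have "bounded U"
    using V(1) V(2)[of 0] bounded_subset by auto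
  have Un: "(Q ^^ n) ` U \<in> lmeasurable \<and> measure lebesgue ((Q ^^ n) ` U) = measure lebesgue U" for n
  proof (induction n)
    case 0
    then show ?case
      using U \<open>bounded U\<close> by (simp add: lmeasurable_open)
  next
    case (Suc n)
    let ?S = "(Q ^^ n) ` U"
    have "Q ` ?S \<in> lmeasurable \<and> measure lebesgue (Q ` ?S) = measure lebesgue U"
    proof (subst has_measure_differentiable_image)
      show "((\<lambda>x. \<bar>det (matrix (Q' x))\<bar>) has_integral measure lebesgue U) ?S"
        using Suc lmeasure_integral[of ?S] by (simp add: det has_integral_iff lmeasurable_iff_integrable_on)
      show "inj_on Q ?S"
        using \<open>inj Q\<close> by (rule inj_on_subset) simp
    qed (use Suc der in \<open>auto intro: has_derivative_at_withinI fmeasurableD\<close>)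
    then show ?case
      by (simp add: image_image)
  qed
  obtain r where "V \<subseteq> ball 0 r"
    using V(1) bounded_subset_ballD by blast
  have "real n * measure lebesgue U \<le> measure lebesgue (ball (0::real^2) r)" for n
  proof -
    have "measure lebesgue (\<Union>i<n. (Q ^^ i) ` U) = (\<Sum>i<n. measure lebesgue ((Q ^^ i) ` U))"
    proof (rule measure_UNION')
      show "pairwise (\<lambda>i j. disjnt ((Q ^^ i) ` U) ((Q ^^ j) ` U)) {..<n}"
        unfolding pairwise_def disjnt_def by (metis disj Int_commute linorder_neqE_nat)
    qed (use Un in auto)
    moreover have "measure lebesgue (\<Union>i<n. (Q ^^ i) ` U) \<le> measure lebesgue (ball (0::real^2) r)"
      using Un V(2) \<open>V \<subseteq> ball 0 r\<close>
      by (intro measure_mono_fmeasurable) (auto intro!: sets.finite_UN fmeasurableD)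
    ultimately show ?thesis
      using Un by simp
  qed
  moreover have "measure lebesgue U > 0"
    using open_not_negligible[OF U] Un[of 0] negligible_iff_measure0[of U]
    by (simp add: less_le)
  ultimately show False
    using reals_Archimedean3 by (metis linorder_not_less)
qed

text \<open>The same on the product \<open>real \<times> real\<close>, by conjugation with the linear isomorphism to \<open>real^2\<close>, where the change of
  variables formula lives.\<close>

lemma no_bounded_wandering_set:
  fixes P :: "real \<times> real \<Rightarrow> real \<times> real"
  assumes "inj P"
    and der: "\<And>z. (P has_derivative (\<lambda>(h, k). (a z * h + b z * k, c z * h + d z * k))) (at z)"
    and det: "\<And>z. a z * d z - b z * c z = 1"
    and U: "open U" "U \<noteq> {}" and V: "bounded V" "\<And>n. (P ^^ n) ` U \<subseteq> V"
  shows "\<exists>n>0. (P ^^ n) ` U \<inter> U \<noteq> {}"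
proof -
  define j where "j = (\<lambda>v::real^2. (v $ 1, v $ 2))"
  define i where "i = (\<lambda>(x::real, y::real). vector [x, y] :: real^2)"
  have ij: "i (j v) = v" and ji: "j (i z) = z" for v z
    by (auto simp: i_def j_def vec_eq_iff forall_2 split: prod.splits)
  have j: "bounded_linear j"
    unfolding j_def by (intro bounded_linear_Pair bounded_linear_vec_nth)
  have "linear i"
    by (rule linearI) (auto simp: i_def vec_eq_iff forall_2 split: prod.splits)
  then have i: "bounded_linear i"
    by (rule linear_conv_bounded_linear[THEN iffD1])
  define Q where "Q v = i (P (j v))" for v
  define Q' where "Q' v = (\<lambda>h. i ((\<lambda>(h, k). (a (j v) * h + b (j v) * k, c (j v) * h + d (j v) * k)) (j h)))" for v
  have Qn: "(Q ^^ n) v = i ((P ^^ n) (j v))" for n v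
    by (induction n) (auto simp: Q_def ij ji)
  have img: "(Q ^^ n) ` i ` U = i ` (P ^^ n) ` U" for n
    by (auto simp: Qn ji image_image)
  have "\<exists>n>0. (Q ^^ n) ` i ` U \<inter> i ` U \<noteq> {}"
  proof (rule no_bounded_wandering_set_vec)
    show "inj Q"
      using \<open>inj P\<close> unfolding inj_def Q_def by (metis ij ji)
    show "(Q has_derivative Q' x) (at x)" for x
      unfolding Q_def Q'_def
      by (intro bounded_linear.has_derivative[OF i] has_derivative_compose[OF _ der]
          bounded_linear_imp_has_derivative[OF j])
    show "det (matrix (Q' x)) = 1" for x
      using det[of "j x"] by (simp add: det_2 matrix_def Q'_def i_def j_def axis_def)
    have "i ` U = j -` U"
      by (auto simp: ij ji) (metis ij image_eqI)
    then show "open (i ` U)"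
      using U(1) by (simp add: open_vimage linear_continuous_on[OF j])
    show "bounded (i ` V)"
      by (rule bounded_linear_image[OF V(1) i])
    show "(Q ^^ n) ` i ` U \<subseteq> i ` V" for n
      using V(2)[of n] by (auto simp: img)
  qed (use U in auto)
  then obtain n where "n > 0" "i ` ((P ^^ n) ` U) \<inter> i ` U \<noteq> {}"
    by (auto simp: img)
  moreover have "inj i"
    by (metis ji injI)
  ultimately show ?thesis
    by (metis image_Int image_empty)
qed

text \<open>\<open>\<tau>\<close> is the horizontal displacement. The points with \<open>\<tau> > 0\<close> lie above the curve \<open>\<tau> = 0\<close> of fixed points and form a
  forward invariant set on which the first coordinate increases. An open set in this region close to \<open>z\<^sub>0\<close>, small enough
  to be separated from its image by a vertical line, never meets its later iterates. Stability would confine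
  all of them to a ball.\<close>

lemma unstable_curve_of_fixed_points:
  fixes P :: "real \<times> real \<Rightarrow> real \<times> real"
  defines "\<tau> \<equiv> \<lambda>z. fst (P z) - fst z"
  assumes "inj P"
    and der: "\<And>z. (P has_derivative (\<lambda>(h, k). (a z * h + b z * k, c z * h + d z * k))) (at z)"
    and det: "\<And>z. a z * d z - b z * c z = 1"
    and twist: "\<And>q p p'. p < p' \<Longrightarrow> \<tau> (q, p) < \<tau> (q, p')"
    and far: "\<And>q p. p \<ge> K \<Longrightarrow> \<tau> (P (q, p)) > 0"
    and fixed: "\<And>z. \<tau> z = 0 \<Longrightarrow> P z = z"
    and "\<tau> z\<^sub>0 = 0"
  shows "\<not> stable_point P z\<^sub>0"
proof
  assume "stable_point P z\<^sub>0"
  then have "open (ball z\<^sub>0 1) \<and> z\<^sub>0 \<in> ball z\<^sub>0 1 \<longrightarrow>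
      (\<exists>W. open W \<and> z\<^sub>0 \<in> W \<and> W \<subseteq> ball z\<^sub>0 1 \<and> (\<forall>n>0. (P ^^ n) ` W \<subseteq> ball z\<^sub>0 1))"
    unfolding stable_point_def by (rule spec)
  then obtain W where W: "open W" "z\<^sub>0 \<in> W" "W \<subseteq> ball z\<^sub>0 1"
      "\<And>n. n > 0 \<Longrightarrow> (P ^^ n) ` W \<subseteq> ball z\<^sub>0 1"
    by auto
  obtain q\<^sub>0 p\<^sub>0 where z0: "z\<^sub>0 = (q\<^sub>0, p\<^sub>0)"
    by fastforce
  have contP: "continuous_on A P" for A
    using der by (meson has_derivative_continuous continuous_at_imp_continuous_on)
  then have cont\<tau>: "continuous_on A \<tau>" for A
    unfolding \<tau>_def by (intro continuous_intros)
  \<comment> \<open>On the vertical half-line above \<open>z\<close> the function \<open>\<tau> \<circ> P\<close> has no zero, since \<open>P\<close> is injective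
    and fixes the zeros of \<open>\<tau>\<close>; far up it is positive.\<close>
  have step: "\<tau> (P z) > 0" if "\<tau> z > 0" for z
  proof (rule ccontr)
    obtain q p where z: "z = (q, p)"
      by fastforce
    assume "\<not> \<tau> (P z) > 0"
    then have "\<exists>x\<ge>p. x \<le> max p K \<and> \<tau> (P (q, x)) = 0"
      using far[of "max p K" q] z
      by (intro IVT' continuous_on_compose2[OF cont\<tau>] continuous_on_compose2[OF contP])
        (auto intro!: continuous_intros simp: less_imp_le)
    then obtain x where x: "x \<ge> p" "\<tau> (P (q, x)) = 0"
      by blast
    then have "P (q, x) = (q, x)"
      using injD[OF \<open>inj P\<close> fixed[of "P (q, x)"]] by simp
    then have "\<tau> (q, x) = 0"
      by (simp add: \<tau>_def)
    then show False
      using that z x twist[of p x q] by (cases "p = x") auto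
  qed
  obtain \<epsilon> where \<epsilon>: "\<epsilon> > 0" "ball z\<^sub>0 \<epsilon> \<subseteq> W"
    using W openE by blast
  define y where "y = (q\<^sub>0, p\<^sub>0 + \<epsilon> / 2)"
  have "y \<in> ball z\<^sub>0 \<epsilon>"
    using \<epsilon> by (simp add: y_def z0 dist_Pair_Pair dist_real_def)
  then have yW: "y \<in> W"
    using \<epsilon> by auto
  have y\<tau>: "\<tau> y > 0"
    using twist[of p\<^sub>0 "p\<^sub>0 + \<epsilon> / 2" q\<^sub>0] \<epsilon> \<open>\<tau> z\<^sub>0 = 0\<close> by (simp add: y_def z0)
  \<comment> \<open>The line \<open>fst = m\<close> separates \<open>U\<close> from all its images.\<close>
  define m where "m = (fst y + fst (P y)) / 2"
  define U where "U = W \<inter> {z. \<tau> z > 0} \<inter> {z. fst z < m} \<inter> {z. fst (P z) > m}"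
  have "open U"
    unfolding U_def using W
    by (intro open_Int open_Collect_less continuous_intros cont\<tau> contP)
  moreover have "y \<in> U"
    using yW y\<tau> by (auto simp: U_def m_def \<tau>_def)
  moreover have inv: "\<tau> ((P ^^ n) z) > 0" if "z \<in> U" for n z
    using that by (induction n) (auto simp: U_def intro: step)
  have right: "fst ((P ^^ Suc n) z) > m" if "z \<in> U" for n z
  proof (induction n)
    case 0
    then show ?case
      using that by (simp add: U_def)
  next
    case (Suc n)
    then show ?case
      using inv[OF that, of "Suc n"] by (simp add: \<tau>_def)
  qed
  have "(P ^^ n) ` U \<subseteq> ball z\<^sub>0 1" for n
    using W(3) W(4)[of n] by (cases "n = 0") (auto simp: U_def)
  ultimately have "\<exists>n>0. (P ^^ n) ` U \<inter> U \<noteq> {}"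
    by (intro no_bounded_wandering_set[where V = "ball z\<^sub>0 1", OF \<open>inj P\<close> der det]) auto
  then obtain n z where n: "n > 0" and z: "z \<in> U" "(P ^^ n) z \<in> U"
    by blast
  have "fst ((P ^^ n) z) < m"
    using z(2) unfolding U_def by blast
  then show False
    using right[OF z(1), of "n - 1"] n by simp
qed

section \<open>The pendulum flow over the reals and over the complex strip\<close>

lemma has_vector_derivative_fst:
  "(u has_vector_derivative d) F \<Longrightarrow> ((\<lambda>t. fst (u t)) has_vector_derivative fst d) F"
  by (rule bounded_linear.has_vector_derivative[OF bounded_linear_fst])

lemma has_vector_derivative_snd:
  "(u has_vector_derivative d) F \<Longrightarrow> ((\<lambda>t. snd (u t)) has_vector_derivative snd d) F"
  by (rule bounded_linear.has_vector_derivative[OF bounded_linear_snd])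

lemma norm_fst_component: "norm (fst x) \<le> norm x"
  using norm_fst_le[of "fst x" "snd x"] by simp

lemma norm_snd_component: "norm (snd x) \<le> norm x"
  using norm_snd_le[of "snd x" "fst x"] by simp

lemma norm_prod_le: "norm x \<le> norm (fst x) + norm (snd x)"
  using norm_Pair_le[of "fst x" "snd x"] by simp

lemma lipschitz_imp_continuous:
  fixes g :: "'a::real_normed_vector \<Rightarrow> 'b::real_normed_vector"
  assumes "\<And>x y. norm (g x - g y) \<le> K * norm (x - y)"
  shows "continuous_on UNIV g"
proof (rule lipschitz_on_continuous_on)
  show "(max K 0)-lipschitz_on UNIV g"
  proof (rule lipschitz_onI)
    show "dist (g x) (g y) \<le> max K 0 * dist x y" for x y
      using order_trans[OF assms mult_right_mono[of K "max K 0"]] by (simp add: dist_norm)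
  qed simp
qed

lemma clamped_lipschitz:
  assumes "\<And>x y. x \<in> strip \<Longrightarrow> y \<in> strip \<Longrightarrow> norm (g x - g y) \<le> K * norm (x - y)" and "K \<ge> 0"
  shows "norm (g (clamp_strip x) - g (clamp_strip y)) \<le> K * norm (x - y)"
  using order_trans[OF assms(1) mult_left_mono[OF clamp_strip_lipschitz \<open>K \<ge> 0\<close>]] by simp

lemma clamped_continuous:
  assumes "\<And>x y. x \<in> strip \<Longrightarrow> y \<in> strip \<Longrightarrow> norm (g x - g y) \<le> K * norm (x - y)" and "K \<ge> 0"
    and "continuous_on UNIV v"
  shows "continuous_on UNIV (\<lambda>t. g (clamp_strip (v t)))"
  by (rule continuous_on_compose2[OF lipschitz_imp_continuous[OF clamped_lipschitz[OF assms(1,2)]] assms(3)]) auto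

definition emb :: "real \<times> real \<Rightarrow> complex \<times> complex" where
  "emb z = (of_real (fst z), of_real (snd z))"

lemma emb_simps [simp]: "fst (emb z) = of_real (fst z)" "snd (emb z) = of_real (snd z)"
  by (simp_all add: emb_def)

lemma bounded_linear_emb: "bounded_linear emb"
  unfolding emb_def
  by (intro bounded_linear_Pair bounded_linear_compose[OF bounded_linear_of_real]
      bounded_linear_fst bounded_linear_snd)

text \<open>With \<open>d = 0\<close> this is periodicity; the positions and the degenerate families need \<open>d \<noteq> 0\<close>.\<close>

lemma quasi_periodic_of_int:
  fixes g :: "real \<Rightarrow> real"
  assumes "\<And>t. g (t + c) = g t + d"
  shows "g (t + of_int k * c) = g t + of_int k * d"
proof -
  have nat: "g (t + of_nat n * c) = g t + of_nat n * d" for t n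
  proof (induction n)
    case (Suc n)
    then show ?case
      using assms[of "t + of_nat n * c"] by (simp add: algebra_simps)
  qed simp
  show ?thesis
    using nat[of t "nat k"] nat[of "t + of_int k * c" "nat (- k)"]
    by (cases "k \<ge> 0") (auto simp: algebra_simps)
qed

lemma ex_int_shift_into_period:
  fixes c s :: real
  assumes "c > 0"
  shows "\<exists>k::int. 0 \<le> s - of_int k * c \<and> s - of_int k * c < c"
proof
  have "of_int \<lfloor>s / c\<rfloor> * c \<le> s / c * c" "s / c * c < (of_int \<lfloor>s / c\<rfloor> + 1) * c"
    using assms floor_correct[of "s / c"] by (intro mult_right_mono mult_strict_right_mono; simp)+
  then show "0 \<le> s - of_int \<lfloor>s / c\<rfloor> * c \<and> s - of_int \<lfloor>s / c\<rfloor> * c < c"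
    using assms by (simp add: algebra_simps)
qed

locale forced_pendulum =
  fixes a T :: real and N :: int and f :: "real \<Rightarrow> real"
  assumes T_pos: "T > 0" and a_pos: "a > 0"
    and f_cont: "continuous_on UNIV f" and f_per: "\<And>t. f (t + T) = f t"
begin

lemma f_bounded: "\<exists>M. \<forall>t. \<bar>f t\<bar> \<le> M"
proof -
  have "bounded (f ` {0..T})"
    by (intro compact_imp_bounded compact_continuous_image continuous_on_subset[OF f_cont]) auto
  then obtain M where "\<forall>y\<in>f ` {0..T}. norm y \<le> M"
    unfolding bounded_iff by blast
  then have M: "\<bar>f s\<bar> \<le> M" if "0 \<le> s" "s \<le> T" for s
    using that by auto
  have "\<bar>f t\<bar> \<le> M" for t
  proof -
    obtain k :: int where k: "0 \<le> t - of_int k * T" "t - of_int k * T < T"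
      using ex_int_shift_into_period[OF T_pos] by blast
    have "f t = f (t - of_int k * T)"
      using quasi_periodic_of_int[of f T 0 "t - of_int k * T" k] f_per by simp
    then show ?thesis
      using M[of "t - of_int k * T"] k by simp
  qed
  then show ?thesis
    by blast
qed

text \<open>A common Lipschitz constant for the real and complex vector fields and their linearizations.\<close>

definition L :: real where "L = 2 + 2 * a"

lemma L_pos: "L > 0"
  using a_pos by (simp add: L_def)

definition rfield :: "real \<Rightarrow> real \<times> real \<Rightarrow> real \<times> real" where
  "rfield t z = (vel (snd z), - a * sin (fst z) + f t)"

text \<open>The holomorphic extension of \<open>rfield\<close> to the strip, made globally Lipschitz by clamping.\<close>

definition cfield :: "real \<Rightarrow> complex \<times> complex \<Rightarrow> complex \<times> complex" where
  "cfield t z = (cvel (clamp_strip (snd z)),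
     - of_real a * sin (clamp_strip (fst z)) + of_real (f t))"

text \<open>The equation linearized along \<open>u\<close>, and its complex counterpart.\<close>

definition rvar :: "(real \<Rightarrow> real \<times> real) \<Rightarrow> real \<Rightarrow> real \<times> real \<Rightarrow> real \<times> real" where
  "rvar u t w = (1 / sqrt (1 + (snd (u t))\<^sup>2) ^ 3 * snd w, - a * cos (fst (u t)) * fst w)"

definition cvar :: "(real \<Rightarrow> complex \<times> complex) \<Rightarrow> real \<Rightarrow> complex \<times> complex \<Rightarrow> complex \<times> complex" where
  "cvar u t w = (cvel' (clamp_strip (snd (u t))) * snd w,
     - of_real a * cos (clamp_strip (fst (u t))) * fst w)"

lemma pair_bound:
  fixes x :: "'a::real_normed_vector \<times> 'a"
  assumes "norm (fst y) \<le> 2 * norm (snd x)" "norm (snd y) \<le> 2 * a * norm (fst x)"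
  shows "norm (y :: 'a \<times> 'a) \<le> L * norm x"
proof -
  have "norm y \<le> 2 * norm (snd x) + 2 * a * norm (fst x)"
    using norm_prod_le[of y] assms by linarith
  also have "\<dots> \<le> 2 * norm x + 2 * a * norm x"
    using a_pos by (intro add_mono mult_left_mono norm_fst_component norm_snd_component) simp_all
  finally show ?thesis
    by (simp add: L_def algebra_simps)
qed

lemma rfield_lipschitz: "norm (rfield t x - rfield t y) \<le> L * norm (x - y)"
proof (rule pair_bound)
  show "norm (fst (rfield t x - rfield t y)) \<le> 2 * norm (snd (x - y))"
    using vel_lipschitz[of "snd x" "snd y"] abs_ge_zero[of "snd x - snd y"]
    unfolding rfield_def by (simp del: abs_ge_zero)
  have "\<bar>sin (fst x) - sin (fst y)\<bar> \<le> \<bar>fst x - fst y\<bar>"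
    using abs_sin_diff_less[of "fst x" "fst y"] by (cases "fst x = fst y") auto
  then have "a * \<bar>sin (fst x) - sin (fst y)\<bar> \<le> 2 * a * \<bar>fst x - fst y\<bar>"
    using a_pos by (intro mult_mono) auto
  moreover have "snd (rfield t x - rfield t y) = - (a * (sin (fst x) - sin (fst y)))"
    by (simp add: rfield_def algebra_simps)
  ultimately show "norm (snd (rfield t x - rfield t y)) \<le> 2 * a * norm (fst (x - y))"
    using a_pos by (simp add: abs_mult)
qed

lemma cfield_lipschitz: "norm (cfield t x - cfield t y) \<le> L * norm (x - y)"
proof (rule pair_bound)
  show "norm (fst (cfield t x - cfield t y)) \<le> 2 * norm (snd (x - y))"
    using clamped_lipschitz[OF cvel_lipschitz] by (simp add: cfield_def)
  have "snd (cfield t x - cfield t y) =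
      - (of_real a * (sin (clamp_strip (fst x)) - sin (clamp_strip (fst y))))"
    by (simp add: cfield_def algebra_simps)
  then show "norm (snd (cfield t x - cfield t y)) \<le> 2 * a * norm (fst (x - y))"
    using clamped_lipschitz[OF sin_lipschitz_strip(1), of "fst x" "fst y"] a_pos
    by (simp add: norm_mult)
qed

lemma cvar_bound: "norm (cvar u t w) \<le> L * norm w"
proof (rule pair_bound)
  show "norm (fst (cvar u t w)) \<le> 2 * norm (snd w)"
    using cvel'_bound by (auto simp: cvar_def norm_mult intro!: mult_right_mono)
  show "norm (snd (cvar u t w)) \<le> 2 * a * norm (fst w)"
    using sin_cos_strip_bound(2)[of "clamp_strip (fst (u t))"] a_pos
    by (auto simp: cvar_def norm_mult intro!: mult_right_mono)
qed

lemma linear_cvar: "linear (cvar u t)"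
  by (rule linearI) (auto simp: cvar_def algebra_simps scaleR_conv_of_real)

lemma cvar_lipschitz: "norm (cvar u t x - cvar u t y) \<le> L * norm (x - y)"
  using cvar_bound[of u t "x - y"] by (simp add: linear_diff[OF linear_cvar])

lemma rvar_bound: "norm (rvar u t w) \<le> L * norm w"
proof (rule pair_bound)
  define c where "c = 1 / sqrt (1 + (snd (u t))\<^sup>2) ^ 3"
  have "c \<le> 1 / 1"
    unfolding c_def
    by (rule divide_left_mono[OF sqrt_one_plus_square_ge]) (simp_all add: one_plus_square_pos)
  then have "c * \<bar>snd w\<bar> \<le> 2 * \<bar>snd w\<bar>"
    by (intro mult_right_mono) auto
  moreover have "c \<ge> 0"
    by (simp add: c_def)
  ultimately show "norm (fst (rvar u t w)) \<le> 2 * norm (snd w)"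
    unfolding rvar_def c_def[symmetric] by (simp add: abs_mult)
  have "\<bar>cos (fst (u t))\<bar> * \<bar>fst w\<bar> \<le> 2 * \<bar>fst w\<bar>"
    by (intro mult_right_mono order_trans[OF abs_cos_le_one]) auto
  then show "norm (snd (rvar u t w)) \<le> 2 * a * norm (fst w)"
    using a_pos by (simp add: rvar_def abs_mult)
qed

lemma rvar_lipschitz: "norm (rvar u t x - rvar u t y) \<le> L * norm (x - y)"
proof -
  have "rvar u t x - rvar u t y = rvar u t (x - y)"
    by (simp add: rvar_def algebra_simps diff_divide_distrib)
  then show ?thesis
    by (simp add: rvar_bound)
qed

definition rflow :: "real \<times> real \<Rightarrow> real \<Rightarrow> real \<times> real" where
  "rflow z = (SOME u. u 0 = z \<and> (\<forall>t. (u has_vector_derivative rfield t (u t)) (at t)))"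

definition cflow :: "complex \<times> complex \<Rightarrow> real \<Rightarrow> complex \<times> complex" where
  "cflow z = (SOME u. u 0 = z \<and> (\<forall>t. (u has_vector_derivative cfield t (u t)) (at t)))"

definition rvflow :: "real \<times> real \<Rightarrow> real \<times> real \<Rightarrow> real \<Rightarrow> real \<times> real" where
  "rvflow z h = (SOME m. m 0 = h \<and> (\<forall>t. (m has_vector_derivative rvar (rflow z) t (m t)) (at t)))"

definition cvflow :: "complex \<times> complex \<Rightarrow> complex \<times> complex \<Rightarrow> real \<Rightarrow> complex \<times> complex" where
  "cvflow z h = (SOME m. m 0 = h \<and> (\<forall>t. (m has_vector_derivative cvar (cflow z) t (m t)) (at t)))"

lemma continuous_vel: "continuous_on UNIV vel"
  by (rule lipschitz_imp_continuous[of _ 1]) (use vel_lipschitz in auto)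

lemma rflow: "rflow z 0 = z" "(rflow z has_vector_derivative rfield t (rflow z t)) (at t)"
proof -
  obtain M where M: "\<And>t. \<bar>f t\<bar> \<le> M"
    using f_bounded by blast
  have "\<exists>u. u 0 = z \<and> (\<forall>t. (u has_vector_derivative rfield t (u t)) (at t))"
  proof (rule ode_global_existence[OF _ rfield_lipschitz L_pos])
    show "continuous_on UNIV (\<lambda>t. rfield t (v t))" if "continuous_on UNIV v" for v
      unfolding rfield_def using that
      by (intro continuous_intros f_cont continuous_on_compose2[OF continuous_vel]) auto
    show "norm (rfield t 0) \<le> M" for t
      using norm_prod_le[of "rfield t 0"] M[of t] by (simp add: rfield_def vel_def)
  qed
  from someI_ex[OF this] show "rflow z 0 = z" "(rflow z has_vector_derivative rfield t (rflow z t)) (at t)"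
    unfolding rflow_def by auto
qed

lemma continuous_flow: "(\<And>t. (u has_vector_derivative X t) (at t)) \<Longrightarrow> continuous_on A u"
  by (meson continuous_at_imp_continuous_on has_vector_derivative_continuous)

lemma cflow: "cflow z 0 = z" "(cflow z has_vector_derivative cfield t (cflow z t)) (at t)"
proof -
  obtain M where M: "\<And>t. \<bar>f t\<bar> \<le> M"
    using f_bounded by blast
  have "\<exists>u. u 0 = z \<and> (\<forall>t. (u has_vector_derivative cfield t (u t)) (at t))"
  proof (rule ode_global_existence[OF _ cfield_lipschitz L_pos])
    show "continuous_on UNIV (\<lambda>t. cfield t (v t))" if "continuous_on UNIV v" for v
      unfolding cfield_def using that
      by (intro continuous_intros f_cont clamped_continuous[OF cvel_lipschitz]
          clamped_continuous[OF sin_lipschitz_strip(1)]) auto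
    have "clamp_strip 0 = 0"
      using clamp_strip_of_real[of 0] by simp
    then show "norm (cfield t 0) \<le> M" for t
      using norm_prod_le[of "cfield t 0"] M[of t] by (simp add: cfield_def cvel_def)
  qed
  from someI_ex[OF this] show "cflow z 0 = z" "(cflow z has_vector_derivative cfield t (cflow z t)) (at t)"
    unfolding cflow_def by auto
qed

lemma rvflow: "rvflow z h 0 = h" "(rvflow z h has_vector_derivative rvar (rflow z) t (rvflow z h t)) (at t)"
proof -
  have "\<exists>u. u 0 = h \<and> (\<forall>t. (u has_vector_derivative rvar (rflow z) t (u t)) (at t))"
  proof (rule ode_global_existence[OF _ rvar_lipschitz L_pos])
    show "continuous_on UNIV (\<lambda>t. rvar (rflow z) t (v t))" if "continuous_on UNIV v" for v
      unfolding rvar_def using that continuous_flow[OF rflow(2), of UNIV z]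
        one_plus_square_pos
      by (intro continuous_intros) (auto simp: less_imp_neq[symmetric])
    show "norm (rvar (rflow z) t 0) \<le> 0" for t
      by (simp add: rvar_def)
  qed
  from someI_ex[OF this]
  show "rvflow z h 0 = h" "(rvflow z h has_vector_derivative rvar (rflow z) t (rvflow z h t)) (at t)"
    unfolding rvflow_def by auto
qed

lemma cvflow: "cvflow z h 0 = h" "(cvflow z h has_vector_derivative cvar (cflow z) t (cvflow z h t)) (at t)"
proof -
  have "\<exists>u. u 0 = h \<and> (\<forall>t. (u has_vector_derivative cvar (cflow z) t (u t)) (at t))"
  proof (rule ode_global_existence[OF _ cvar_lipschitz L_pos])
    show "continuous_on UNIV (\<lambda>t. cvar (cflow z) t (v t))" if "continuous_on UNIV v" for v
      unfolding cvar_def using that continuous_flow[OF cflow(2), of UNIV z]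
      by (intro continuous_intros clamped_continuous[OF cvel'_lipschitz]
          clamped_continuous[OF sin_lipschitz_strip(2)]) auto
    show "norm (cvar (cflow z) t 0) \<le> 0" for t
      by (simp add: cvar_def)
  qed
  from someI_ex[OF this]
  show "cvflow z h 0 = h" "(cvflow z h has_vector_derivative cvar (cflow z) t (cvflow z h t)) (at t)"
    unfolding cvflow_def by auto
qed

lemma rflow_unique:
  assumes "\<And>t. (u has_vector_derivative rfield t (u t)) (at t)"
  shows "u = rflow (u 0)"
  by (rule ext, rule ode_uniqueness[OF assms rflow(2) rfield_lipschitz, where s = 0])
    (use L_pos rflow(1) in auto)

lemma rflow_inj: "rflow z s = rflow w s \<Longrightarrow> z = w"
  using ode_uniqueness[OF rflow(2)[of z] rflow(2)[of w] rfield_lipschitz, of s 0] L_pos rflow(1)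
  by auto

text \<open>Both sides solve the same complex initial value problem. Real flow and real variational equation are thus
  restrictions of the complex ones, and real derivatives can be read off from complex derivatives.\<close>

lemma cflow_emb: "cflow (emb z) t = emb (rflow z t)"
proof (rule ode_uniqueness[OF cflow(2) _ cfield_lipschitz, where s = 0])
  fix t
  have "((\<lambda>t. emb (rflow z t)) has_vector_derivative emb (rfield t (rflow z t))) (at t)"
    by (rule bounded_linear.has_vector_derivative[OF bounded_linear_emb rflow(2)])
  moreover have "emb (rfield t w) = cfield t (emb w)" for w
    by (simp add: emb_def rfield_def cfield_def cvel_of_real flip: sin_of_real)
  ultimately show "((\<lambda>t. emb (rflow z t)) has_vector_derivative cfield t (emb (rflow z t))) (at t)"
    by simp
qed (use L_pos cflow(1) rflow(1) in auto)

lemma cvflow_emb: "cvflow (emb z) (emb h) t = emb (rvflow z h t)"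
proof (rule ode_uniqueness[OF cvflow(2) _ cvar_lipschitz, where s = 0])
  fix t
  have "((\<lambda>t. emb (rvflow z h t)) has_vector_derivative emb (rvar (rflow z) t (rvflow z h t))) (at t)"
    by (rule bounded_linear.has_vector_derivative[OF bounded_linear_emb rvflow(2)])
  moreover have "emb (rvar (rflow z) t w) = cvar (cflow (emb z)) t (emb w)" for w
    by (simp add: rvar_def cvar_def cflow_emb cvel'_of_real cos_of_real)
      (simp add: emb_def flip: cos_of_real)
  ultimately show "((\<lambda>t. emb (rvflow z h t)) has_vector_derivative cvar (cflow (emb z)) t (emb (rvflow z h t))) (at t)"
    by simp
qed (use L_pos cvflow(1) rvflow(1) in auto)

section \<open>Differentiability of the flow and conservation of area\<close>

text \<open>Initial states so close to the real ones that, by the Lipschitz dependence on initial values, the trajectory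
  stays in the strip up to time \<open>T\<close>, where clamping has no effect.\<close>

definition tube :: "(complex \<times> complex) set" where
  "tube = {z. exp ((L + 1) * T) * (\<bar>Im (fst z)\<bar> + \<bar>Im (snd z)\<bar>) < 1 / 2}"

lemma open_tube: "open tube"
  unfolding tube_def by (intro open_Collect_less continuous_intros)

lemma emb_in_tube: "emb z \<in> tube"
  by (simp add: tube_def)

lemma cflow_stays_in_strip:
  assumes "z \<in> tube" "0 \<le> t" "t \<le> T"
  shows "fst (cflow z t) \<in> strip" "snd (cflow z t) \<in> strip"
proof -
  define w where "w = (Re (fst z), Re (snd z))"
  have "norm (z - emb w) \<le> \<bar>Im (fst z)\<bar> + \<bar>Im (snd z)\<bar>"
    using norm_prod_le[of "z - emb w"] by (simp add: w_def cmod_def)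
  then have "norm (cflow z t - emb (rflow w t)) \<le> exp ((L + 1) * T) * (\<bar>Im (fst z)\<bar> + \<bar>Im (snd z)\<bar>)"
    unfolding cflow_emb[symmetric] using assms L_pos
    by (intro order_trans[OF ode_lipschitz_dependence[OF cflow(2) cflow(2) cfield_lipschitz]] mult_mono)
      (auto simp: cflow(1) intro: mult_left_mono)
  also have "\<dots> < 1 / 2"
    using assms by (simp add: tube_def)
  finally have *: "norm (cflow z t - emb (rflow w t)) < 1 / 2" .
  have "\<bar>Im (fst (cflow z t))\<bar> \<le> norm (fst (cflow z t - emb (rflow w t)))"
    using abs_Im_le_cmod[of "fst (cflow z t - emb (rflow w t))"] by simp
  also have "\<dots> \<le> norm (cflow z t - emb (rflow w t))"
    by (rule norm_fst_component)
  finally show "fst (cflow z t) \<in> strip"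
    using * by (simp add: strip_def)
  have "\<bar>Im (snd (cflow z t))\<bar> \<le> norm (snd (cflow z t - emb (rflow w t)))"
    using abs_Im_le_cmod[of "snd (cflow z t - emb (rflow w t))"] by simp
  also have "\<dots> \<le> norm (cflow z t - emb (rflow w t))"
    by (rule norm_snd_component)
  finally show "snd (cflow z t) \<in> strip"
    using * by (simp add: strip_def)
qed

lemma cvflow_linear:
  "cvflow z (h, k) t = (fst (cvflow z (1, 0) t) * h + fst (cvflow z (0, 1) t) * k,
     snd (cvflow z (1, 0) t) * h + snd (cvflow z (0, 1) t) * k)"
proof (rule ode_uniqueness[OF cvflow(2) _ cvar_lipschitz, where s = 0])
  fix t
  let ?m = "cvflow z (1, 0)" let ?n = "cvflow z (0, 1)"
  have "((\<lambda>t. (fst (?m t) * h + fst (?n t) * k, snd (?m t) * h + snd (?n t) * k)) has_vector_derivative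
      (fst (cvar (cflow z) t (?m t)) * h + fst (cvar (cflow z) t (?n t)) * k,
       snd (cvar (cflow z) t (?m t)) * h + snd (cvar (cflow z) t (?n t)) * k)) (at t)"
    by (intro has_vector_derivative_Pair has_vector_derivative_add has_vector_derivative_mult_left
        has_vector_derivative_fst has_vector_derivative_snd cvflow(2))
  then show "((\<lambda>t. (fst (?m t) * h + fst (?n t) * k, snd (?m t) * h + snd (?n t) * k)) has_vector_derivative
      cvar (cflow z) t (fst (?m t) * h + fst (?n t) * k, snd (?m t) * h + snd (?n t) * k)) (at t)"
    by (simp add: cvar_def algebra_simps)
qed (use L_pos cvflow(1) in auto)

text \<open>Here the three points must lie in the strip: outside it the clamped field is not holomorphic.\<close>

lemma cfield_second_order:
  assumes "fst x \<in> strip" "snd x \<in> strip" "fst y \<in> strip" "snd y \<in> strip"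
    "fst (u t) \<in> strip" "snd (u t) \<in> strip"
  shows "norm (cfield t x - cfield t y - cvar u t (x - y))
    \<le> (13 + 2 * a) * (norm (x - u t) + norm (y - u t)) * norm (x - y)"
proof -
  let ?D = "(norm (x - u t) + norm (y - u t)) * norm (x - y)"
  let ?d = "cfield t x - cfield t y - cvar u t (x - y)"
  have "norm (cvel (snd x) - cvel (snd y) - cvel' (snd (u t)) * (snd x - snd y))
      \<le> 13 * (norm (snd x - snd (u t)) + norm (snd y - snd (u t))) * norm (snd x - snd y)"
    using assms by (intro strict_derivative_bound[OF convex_strip] cvel_has_derivative cvel'_lipschitz) auto
  also have "\<dots> \<le> 13 * (norm (x - u t) + norm (y - u t)) * norm (x - y)"
    using norm_snd_component[of "x - u t"] norm_snd_component[of "y - u t"] norm_snd_component[of "x - y"]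
    by (intro mult_mono add_mono) auto
  finally have 1: "norm (fst ?d) \<le> 13 * ?D"
    using assms by (simp only: cfield_def cvar_def clamp_strip_id mult.assoc fst_diff snd_diff fst_conv)
  have "norm (sin (fst x) - sin (fst y) - cos (fst (u t)) * (fst x - fst y))
      \<le> 2 * (norm (fst x - fst (u t)) + norm (fst y - fst (u t))) * norm (fst x - fst y)"
    using assms by (intro strict_derivative_bound[OF convex_strip] DERIV_sin sin_lipschitz_strip) auto
  also have "\<dots> \<le> 2 * (norm (x - u t) + norm (y - u t)) * norm (x - y)"
    using norm_fst_component[of "x - u t"] norm_fst_component[of "y - u t"] norm_fst_component[of "x - y"]
    by (intro mult_mono add_mono) auto
  finally have "a * norm (sin (fst x) - sin (fst y) - cos (fst (u t)) * (fst x - fst y)) \<le> a * (2 * ?D)"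
    using a_pos by (intro mult_left_mono) (simp_all only: mult.assoc less_imp_le)
  moreover have "snd ?d = - (of_real a * (sin (fst x) - sin (fst y) - cos (fst (u t)) * (fst x - fst y)))"
    using assms by (simp add: cfield_def cvar_def clamp_strip_id algebra_simps)
  ultimately have "norm (snd ?d) \<le> a * (2 * ?D)"
    using a_pos by (simp add: norm_mult)
  with 1 norm_prod_le[of ?d] have "norm ?d \<le> 13 * ?D + a * (2 * ?D)"
    by linarith
  then show ?thesis
    by (simp add: algebra_simps)
qed

lemma cflow_strict:
  assumes "z\<^sub>0 \<in> tube" "z\<^sub>1 \<in> tube" "z\<^sub>2 \<in> tube"
  shows "norm (cflow z\<^sub>1 T - cflow z\<^sub>2 T - cvflow z\<^sub>0 (z\<^sub>1 - z\<^sub>2) T)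
    \<le> (13 + 2 * a) * exp ((L + 1) * T) ^ 3 * (norm (z\<^sub>1 - z\<^sub>0) + norm (z\<^sub>2 - z\<^sub>0)) * norm (z\<^sub>1 - z\<^sub>2)"
proof -
  define z where "z i = (if i = 0 then z\<^sub>0 else if i = 1 then z\<^sub>1 else z\<^sub>2)" for i :: nat
  have z: "z 0 = z\<^sub>0" "z 1 = z\<^sub>1" "z 2 = z\<^sub>2"
    by (auto simp: z_def)
  have tube: "z i \<in> tube" for i
    using assms by (auto simp: z_def)
  have "norm (cflow (z 1) T - cflow (z 2) T - cvflow z\<^sub>0 (z\<^sub>1 - z\<^sub>2) T)
      \<le> (13 + 2 * a) * exp ((L + 1) * T) ^ 3 *
        (norm (cflow (z 1) 0 - cflow (z 0) 0) + norm (cflow (z 2) 0 - cflow (z 0) 0)) *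
        norm (cflow (z 1) 0 - cflow (z 2) 0)"
  proof (rule ode_strict_derivative[where u = "\<lambda>i. cflow (z i)" and A = "cvar (cflow z\<^sub>0)",
      OF cflow(2) cfield_lipschitz cvflow(2) _ linear_cvar cvar_bound])
    show "norm (cfield t (cflow (z 1) t) - cfield t (cflow (z 2) t) -
        cvar (cflow z\<^sub>0) t (cflow (z 1) t - cflow (z 2) t))
      \<le> (13 + 2 * a) * (norm (cflow (z 1) t - cflow (z 0) t) + norm (cflow (z 2) t - cflow (z 0) t)) *
        norm (cflow (z 1) t - cflow (z 2) t)" if "0 \<le> t" "t \<le> T" for t
      unfolding z(1) using that assms
      by (intro cfield_second_order cflow_stays_in_strip tube) auto
    show "cvflow z\<^sub>0 (z\<^sub>1 - z\<^sub>2) 0 = cflow (z 1) 0 - cflow (z 2) 0"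
      by (simp only: z cflow(1) cvflow(1))
  qed (use L_pos a_pos T_pos in auto)
  then show ?thesis
    by (simp only: z cflow(1))
qed

lemma strictly_differentiable_cflow:
  "strictly_differentiable_on (\<lambda>z. fst (cflow z T)) (\<lambda>z. fst (cvflow z (1, 0) T)) (\<lambda>z. fst (cvflow z (0, 1) T)) tube"
  "strictly_differentiable_on (\<lambda>z. snd (cflow z T)) (\<lambda>z. snd (cvflow z (1, 0) T)) (\<lambda>z. snd (cvflow z (0, 1) T)) tube"
proof -
  let ?C = "(13 + 2 * a) * exp ((L + 1) * T) ^ 3"
  have C: "0 \<le> ?C"
    using a_pos by simp
  have eq: "cvflow z (x - y) T = (fst (cvflow z (1, 0) T) * (fst x - fst y) + fst (cvflow z (0, 1) T) * (snd x - snd y),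
      snd (cvflow z (1, 0) T) * (fst x - fst y) + snd (cvflow z (0, 1) T) * (snd x - snd y))" for x y z
  proof -
    have "x - y = (fst x - fst y, snd x - snd y)"
      by (simp add: prod_eq_iff)
    then show ?thesis
      by (rule trans[OF arg_cong[where f = "\<lambda>v. cvflow z v T"] cvflow_linear])
  qed
  show "strictly_differentiable_on (\<lambda>z. fst (cflow z T)) (\<lambda>z. fst (cvflow z (1, 0) T)) (\<lambda>z. fst (cvflow z (0, 1) T)) tube"
    unfolding strictly_differentiable_on_def
  proof (intro exI[of _ ?C] conjI C ballI)
    fix z\<^sub>0 z\<^sub>1 z\<^sub>2 assume z: "z\<^sub>0 \<in> tube" "z\<^sub>1 \<in> tube" "z\<^sub>2 \<in> tube"
    from order_trans[OF norm_fst_component cflow_strict[OF z]]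
    show "norm (fst (cflow z\<^sub>1 T) - fst (cflow z\<^sub>2 T) -
        (fst (cvflow z\<^sub>0 (1, 0) T) * (fst z\<^sub>1 - fst z\<^sub>2) + fst (cvflow z\<^sub>0 (0, 1) T) * (snd z\<^sub>1 - snd z\<^sub>2)))
      \<le> ?C * (norm (z\<^sub>1 - z\<^sub>0) + norm (z\<^sub>2 - z\<^sub>0)) * norm (z\<^sub>1 - z\<^sub>2)"
      unfolding eq fst_diff fst_conv .
  qed
  show "strictly_differentiable_on (\<lambda>z. snd (cflow z T)) (\<lambda>z. snd (cvflow z (1, 0) T)) (\<lambda>z. snd (cvflow z (0, 1) T)) tube"
    unfolding strictly_differentiable_on_def
  proof (intro exI[of _ ?C] conjI C ballI)
    fix z\<^sub>0 z\<^sub>1 z\<^sub>2 assume z: "z\<^sub>0 \<in> tube" "z\<^sub>1 \<in> tube" "z\<^sub>2 \<in> tube"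
    from order_trans[OF norm_snd_component cflow_strict[OF z]]
    show "norm (snd (cflow z\<^sub>1 T) - snd (cflow z\<^sub>2 T) -
        (snd (cvflow z\<^sub>0 (1, 0) T) * (fst z\<^sub>1 - fst z\<^sub>2) + snd (cvflow z\<^sub>0 (0, 1) T) * (snd z\<^sub>1 - snd z\<^sub>2)))
      \<le> ?C * (norm (z\<^sub>1 - z\<^sub>0) + norm (z\<^sub>2 - z\<^sub>0)) * norm (z\<^sub>1 - z\<^sub>2)"
      unfolding eq snd_diff snd_conv .
  qed
qed

lemma rflow_has_derivative:
  "((\<lambda>z. rflow z T) has_derivative (\<lambda>(h, k).
     (fst (rvflow z (1, 0) T) * h + fst (rvflow z (0, 1) T) * k,
      snd (rvflow z (1, 0) T) * h + snd (rvflow z (0, 1) T) * k))) (at z)"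
proof -
  have e: "(1, 0) = emb (1, 0)" "(0, 1) = emb (0, 1)"
    by (simp_all add: emb_def)
  have "((\<lambda>z. (Re (fst (cflow (emb z) T)), Re (snd (cflow (emb z) T)))) has_derivative
      (\<lambda>h. (Re (fst (cvflow (emb z) (1, 0) T) * fst (emb h) + fst (cvflow (emb z) (0, 1) T) * snd (emb h)),
        Re (snd (cvflow (emb z) (1, 0) T) * fst (emb h) + snd (cvflow (emb z) (0, 1) T) * snd (emb h))))) (at z)"
    by (intro has_derivative_Pair bounded_linear.has_derivative[OF bounded_linear_Re]
        has_derivative_compose[OF bounded_linear_imp_has_derivative[OF bounded_linear_emb]]
        strictly_differentiable_on_has_derivative[OF strictly_differentiable_cflow(1) open_tube emb_in_tube]
        strictly_differentiable_on_has_derivative[OF strictly_differentiable_cflow(2) open_tube emb_in_tube])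
  then show ?thesis
    unfolding e cflow_emb cvflow_emb
    by (simp add: case_prod_unfold)
qed

text \<open>Liouville: the linearized system has trace zero, so its Wronskian is constant.\<close>

lemma rvflow_det: "fst (rvflow z (1, 0) t) * snd (rvflow z (0, 1) t) - fst (rvflow z (0, 1) t) * snd (rvflow z (1, 0) t) = 1"
proof -
  let ?m = "rvflow z (1, 0)" let ?n = "rvflow z (0, 1)"
  let ?J = "\<lambda>t. fst (?m t) * snd (?n t) - fst (?n t) * snd (?m t)"
  have d: "((\<lambda>t. fst (rvflow z h t)) has_real_derivative fst (rvar (rflow z) t (rvflow z h t))) (at t)"
    "((\<lambda>t. snd (rvflow z h t)) has_real_derivative snd (rvar (rflow z) t (rvflow z h t))) (at t)" for h t
    unfolding has_real_derivative_iff_has_vector_derivative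
    by (intro has_vector_derivative_fst has_vector_derivative_snd rvflow(2))+
  have "(?J has_real_derivative
      (fst (?m t) * snd (rvar (rflow z) t (?n t)) + fst (rvar (rflow z) t (?m t)) * snd (?n t)) -
      (fst (?n t) * snd (rvar (rflow z) t (?m t)) + fst (rvar (rflow z) t (?n t)) * snd (?m t))) (at t)" for t
    by (intro DERIV_diff DERIV_mult' d)
  moreover have "(fst (?m t) * snd (rvar (rflow z) t (?n t)) + fst (rvar (rflow z) t (?m t)) * snd (?n t)) -
      (fst (?n t) * snd (rvar (rflow z) t (?m t)) + fst (rvar (rflow z) t (?n t)) * snd (?m t)) = 0" for t
    by (simp add: rvar_def algebra_simps)
  ultimately have "(?J has_real_derivative 0) (at t)" for t
    by simp
  then have "?J t = ?J 0"
    by (intro DERIV_isconst_all) auto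
  then show ?thesis
    by (simp add: rvflow(1))
qed

section \<open>The Poincare map and its twist\<close>

lemma rflow_components:
  "((\<lambda>t. fst (rflow z t)) has_real_derivative vel (snd (rflow z t))) (at t)"
  "((\<lambda>t. snd (rflow z t)) has_real_derivative - a * sin (fst (rflow z t)) + f t) (at t)"
  using has_vector_derivative_fst[OF rflow(2)] has_vector_derivative_snd[OF rflow(2)]
  unfolding has_real_derivative_iff_has_vector_derivative by (simp_all add: rfield_def)

lemma rvflow_components:
  "((\<lambda>t. fst (rvflow z h t)) has_real_derivative 1 / sqrt (1 + (snd (rflow z t))\<^sup>2) ^ 3 * snd (rvflow z h t)) (at t)"
  "((\<lambda>t. snd (rvflow z h t)) has_real_derivative - (a * cos (fst (rflow z t))) * fst (rvflow z h t)) (at t)"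
  using has_vector_derivative_fst[OF rvflow(2)] has_vector_derivative_snd[OF rvflow(2)]
  unfolding has_real_derivative_iff_has_vector_derivative by (simp_all add: rvar_def)

lemma system_solution_iff_rflow:
  "system_solution a f q p \<longleftrightarrow> (\<forall>t. (q t, p t) = rflow (q 0, p 0) t)"
proof
  assume s: "system_solution a f q p"
  have "((\<lambda>t. (q t, p t)) has_vector_derivative rfield t (q t, p t)) (at t)" for t
    using s unfolding system_solution_def has_real_derivative_iff_has_vector_derivative
    by (auto simp: rfield_def vel_def intro: has_vector_derivative_Pair)
  from rflow_unique[of "\<lambda>t. (q t, p t)", OF this] show "\<forall>t. (q t, p t) = rflow (q 0, p 0) t"
    by metis
next
  assume "\<forall>t. (q t, p t) = rflow (q 0, p 0) t"
  then have "q = (\<lambda>t. fst (rflow (q 0, p 0) t))" "p = (\<lambda>t. snd (rflow (q 0, p 0) t))"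
    by (metis fst_conv, metis snd_conv)
  then show "system_solution a f q p"
    unfolding system_solution_def using rflow_components[of "(q 0, p 0)"]
    by (metis vel_def)
qed

lemma system_solution_of_rflow: "system_solution a f (\<lambda>t. fst (rflow z t)) (\<lambda>t. snd (rflow z t))"
  unfolding system_solution_iff_rflow by (simp add: rflow(1))

abbreviation "P \<equiv> poincare_map a f T N"

lemma flow_at_eq: "flow_at a f t z = rflow z t"
  unfolding flow_at_def
proof (rule the_equality)
  show "\<exists>q p. system_solution a f q p \<and> (q 0, p 0) = z \<and> (q t, p t) = rflow z t"
    using system_solution_of_rflow[of z] by (intro exI conjI) (auto simp: rflow(1))
  show "w = rflow z t" if "\<exists>q p. system_solution a f q p \<and> (q 0, p 0) = z \<and> (q t, p t) = w" for w
    using that system_solution_iff_rflow[THEN iffD1, rule_format] by blast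
qed

lemma P_eq: "P z = (fst (rflow z T) - 2 * of_int N * pi, snd (rflow z T))"
  by (simp add: poincare_map_def flow_at_eq prod_eq_iff)

lemma rflow_shift: "rflow (q + 2 * pi * of_int k, p) t = rflow (q, p) t + (2 * pi * of_int k, 0)"
proof -
  have "((\<lambda>t. rflow (q, p) t + (2 * pi * of_int k, 0)) has_vector_derivative
      rfield t (rflow (q, p) t + (2 * pi * of_int k, 0))) (at t)" for t
  proof -
    have "sin (x + 2 * pi * of_int k) = sin x" for x :: real
      by (simp add: sin_add mult.commute[of pi])
    then have "rfield t (w + (2 * pi * of_int k, 0)) = rfield t w + 0" for w
      by (simp add: rfield_def)
    then show ?thesis
      by (simp only:) (intro has_vector_derivative_add has_vector_derivative_const rflow(2))
  qed
  from rflow_unique[OF this] show ?thesis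
    by (simp add: rflow(1) fun_eq_iff)
qed

lemma P_shift: "P (q + 2 * pi * of_int k, p) = P (q, p) + (2 * pi * of_int k, 0)"
  by (simp add: P_eq rflow_shift prod_eq_iff)

lemma periodic_iff_fixed:
  assumes "system_solution a f q p"
  shows "periodic_system_solution a f T N q p \<longleftrightarrow> P (q 0, p 0) = (q 0, p 0)"
proof
  assume "periodic_system_solution a f T N q p"
  then have "\<forall>t. q (t + T) = q t + 2 * of_int N * pi \<and> p (t + T) = p t"
    unfolding periodic_system_solution_def by (rule conjunct2)
  from spec[OF this, of 0] have "q T = q 0 + 2 * of_int N * pi" "p T = p 0"
    by simp_all
  moreover have "rflow (q 0, p 0) T = (q T, p T)"
    using system_solution_iff_rflow[THEN iffD1, rule_format, OF assms, of T] by (rule sym)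
  ultimately show "P (q 0, p 0) = (q 0, p 0)"
    by (simp add: P_eq)
next
  assume fixed: "P (q 0, p 0) = (q 0, p 0)"
  let ?z = "(q 0, p 0)"
  have sol: "(q t, p t) = rflow ?z t" for t
    by (rule system_solution_iff_rflow[THEN iffD1, rule_format, OF assms])
  have "rflow ?z T = (q 0 + 2 * pi * of_int N, p 0)"
    using fixed by (simp add: P_eq prod_eq_iff algebra_simps)
  moreover have "((\<lambda>t. rflow ?z (t + T)) has_vector_derivative rfield t (rflow ?z (t + T))) (at t)" for t
  proof -
    have "((\<lambda>t. t + T) has_vector_derivative 1) (at t)"
      by (auto simp flip: has_real_derivative_iff_has_vector_derivative intro!: derivative_eq_intros)
    from vector_diff_chain_at[OF this rflow(2)] show ?thesis
      by (simp add: o_def rfield_def f_per)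
  qed
  from rflow_unique[OF this] have "rflow ?z (t + T) = rflow (rflow ?z T) t" for t
    by (simp add: fun_eq_iff)
  ultimately have "rflow ?z (t + T) = rflow ?z t + (2 * pi * of_int N, 0)" for t
    by (simp add: rflow_shift)
  then show "periodic_system_solution a f T N q p"
    unfolding sol[symmetric] periodic_system_solution_def using assms
    by (simp add: mult_ac)
qed

lemma inj_P: "inj P"
  by (rule injI, rule rflow_inj[of _ T]) (simp add: P_eq prod_eq_iff)

lemma P_has_derivative:
  "(P has_derivative (\<lambda>(h, k).
     (fst (rvflow z (1, 0) T) * h + fst (rvflow z (0, 1) T) * k,
      snd (rvflow z (1, 0) T) * h + snd (rvflow z (0, 1) T) * k))) (at z)"
proof -
  have "P = (\<lambda>z. rflow z T - (2 * of_int N * pi, 0))"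
    by (simp add: fun_eq_iff P_eq prod_eq_iff)
  then show ?thesis
    using has_derivative_diff[OF rflow_has_derivative has_derivative_const] by simp
qed

lemma continuous_P: "continuous_on A P"
  using P_has_derivative by (meson has_derivative_continuous continuous_at_imp_continuous_on)

text \<open>The position gained over one period beyond \<open>2 N pi\<close>.\<close>

definition \<tau> :: "real \<times> real \<Rightarrow> real" where
  "\<tau> z = fst (P z) - fst z"

lemma continuous_\<tau>: "continuous_on A \<tau>"
  unfolding \<tau>_def by (intro continuous_intros continuous_P)

lemma displacement_mean_value:
  obtains t where "0 < t" "t < T" "\<tau> z = T * vel (snd (rflow z t)) - 2 * of_int N * pi"
proof -
  obtain t where "0 < t" "t < T" "fst (rflow z T) - fst (rflow z 0) = (T - 0) * vel (snd (rflow z t))"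
    using MVT2[OF T_pos rflow_components(1)] by blast
  then show ?thesis
    using that[of t] by (simp add: \<tau>_def P_eq rflow(1))
qed

lemma no_fixed_point_if_too_fast:
  assumes "\<bar>2 * of_int N * pi\<bar> \<ge> T"
  shows "\<tau> z \<noteq> 0"
proof (rule displacement_mean_value[of z])
  fix t assume "\<tau> z = T * vel (snd (rflow z t)) - 2 * of_int N * pi"
  moreover have "T * \<bar>vel (snd (rflow z t))\<bar> < T * 1"
    using T_pos abs_vel_less by (intro mult_strict_left_mono) auto
  then have "\<bar>T * vel (snd (rflow z t))\<bar> < T"
    using T_pos by (simp add: abs_mult)
  ultimately show "\<tau> z \<noteq> 0"
    using assms by linarith
qed

lemma momentum_drift: "\<exists>C\<ge>0. \<forall>z t. 0 \<le> t \<longrightarrow> t \<le> T \<longrightarrow> \<bar>snd (rflow z t) - snd z\<bar> \<le> C"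
proof -
  obtain M where M: "\<And>t. \<bar>f t\<bar> \<le> M"
    using f_bounded by blast
  have "M \<ge> 0"
    using order_trans[OF abs_ge_zero M] .
  have b: "\<bar>- a * sin x + f t\<bar> \<le> a + M" for x t
  proof -
    have "\<bar>a * sin x\<bar> \<le> a * 1"
      unfolding abs_mult using a_pos by (intro mult_mono) auto
    then show ?thesis
      using M[of t] by linarith
  qed
  have "\<bar>snd (rflow z t) - snd z\<bar> \<le> (a + M) * T" if t: "0 \<le> t" "t \<le> T" for z t
  proof -
    have "norm (snd (rflow z t) - snd (rflow z 0)) \<le> (a + M) * norm (t - 0)"
      by (rule field_differentiable_bound[where S = UNIV and f' = "\<lambda>t. - a * sin (fst (rflow z t)) + f t"])
        (use rflow_components(2) b in auto)
    also have "\<dots> \<le> (a + M) * T"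
      using t a_pos \<open>M \<ge> 0\<close> by (intro mult_left_mono) auto
    finally show ?thesis
      by (simp add: rflow(1))
  qed
  then show ?thesis
    using a_pos T_pos \<open>M \<ge> 0\<close> by (intro exI[of _ "(a + M) * T"]) auto
qed

text \<open>The momentum changes by a bounded amount \<open>C\<close> over one period. A momentum that is initially large enough
  therefore keeps the velocity above \<open>2 \<bar>N\<bar> pi / T < 1\<close>. One further \<open>C\<close> provides for the second period.\<close>

lemma far_displacement:
  assumes "\<bar>2 * of_int N * pi\<bar> < T"
  shows "\<exists>K. \<forall>q p. (p \<ge> K \<longrightarrow> \<tau> (q, p) > 0 \<and> \<tau> (P (q, p)) > 0) \<and> (p \<le> - K \<longrightarrow> \<tau> (q, p) < 0)"
proof -
  obtain C where "C \<ge> 0" and C: "\<And>z t. 0 \<le> t \<Longrightarrow> t \<le> T \<Longrightarrow> \<bar>snd (rflow z t) - snd z\<bar> \<le> C"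
    using momentum_drift by blast
  define c where "c = \<bar>2 * of_int N * pi\<bar> / T"
  have c: "\<bar>c\<bar> < 1" "T * c = \<bar>2 * of_int N * pi\<bar>"
    using assms T_pos by (auto simp: c_def)
  define k where "k = c / sqrt (1 - c\<^sup>2)"
  have vel_k: "vel p > c" if "p > k" for p
    using vel_gt[OF c(1)] that by (simp add: k_def)
  have pos: "\<tau> z > 0" if "snd z > k + C" for z
  proof (rule displacement_mean_value[of z])
    fix t assume t: "0 < t" "t < T" "\<tau> z = T * vel (snd (rflow z t)) - 2 * of_int N * pi"
    have "snd (rflow z t) > k"
      using C[of t z] t that by linarith
    then have "T * c < T * vel (snd (rflow z t))"
      using vel_k T_pos by simp
    then show "\<tau> z > 0"
      using t c by linarith
  qed
  have neg: "\<tau> z < 0" if "snd z < - (k + C)" for z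
  proof (rule displacement_mean_value[of z])
    fix t assume t: "0 < t" "t < T" "\<tau> z = T * vel (snd (rflow z t)) - 2 * of_int N * pi"
    have "- snd (rflow z t) > k"
      using C[of t z] t that by linarith
    moreover have "vel (- x) = - vel x" for x
      by (simp add: vel_def)
    ultimately have "c < - vel (snd (rflow z t))"
      using vel_k by metis
    then have "T * c < T * - vel (snd (rflow z t))"
      using T_pos by (simp only: mult_less_cancel_left_pos)
    then show "\<tau> z < 0"
      using t c by linarith
  qed
  have "\<tau> (P (q, p)) > 0" if "p > k + 2 * C" for q p
    using C[of T "(q, p)"] T_pos that by (intro pos) (simp add: P_eq)
  then show ?thesis
    using pos neg \<open>C \<ge> 0\<close> by (intro exI[of _ "k + 2 * C + 1"]) auto
qed

text \<open>The differences \<open>d\<close>, \<open>e\<close> of positions and momenta satisfy a linear system whose coefficients are difference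
  quotients of \<open>vel\<close> and \<open>a sin\<close>. Since \<open>\<beta> < a\<close> strictly, the rigid alternative of the Sturm comparison is impossible.\<close>

lemma twist:
  assumes "a \<le> (pi / T)\<^sup>2" and "p < p'"
  shows "\<tau> (q, p) < \<tau> (q, p')"
proof (rule ccontr)
  assume neg: "\<not> \<tau> (q, p) < \<tau> (q, p')"
  let ?u = "rflow (q, p)" let ?v = "rflow (q, p')"
  define d where "d t = fst (?v t) - fst (?u t)" for t
  define e where "e t = snd (?v t) - snd (?u t)" for t
  \<comment> \<open>Where a difference vanishes, the quotient is given a value within the bounds that Sturm comparison needs.\<close>
  define \<alpha> where "\<alpha> t = (if e t = 0 then 1 else (vel (snd (?v t)) - vel (snd (?u t))) / e t)" for t
  define \<beta> where "\<beta> t = (if d t = 0 then 0 else a * (sin (fst (?v t)) - sin (fst (?u t))) / d t)" for t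
  have "vel (snd (?v t)) - vel (snd (?u t)) = \<alpha> t * e t" for t
    by (auto simp: \<alpha>_def e_def)
  then have der_d: "(d has_real_derivative \<alpha> t * e t) (at t)" for t
    using DERIV_diff[OF rflow_components(1)[of "(q, p')" t] rflow_components(1)[of "(q, p)" t]]
    by (simp add: d_def[abs_def])
  have "(- a * sin (fst (?v t)) + f t) - (- a * sin (fst (?u t)) + f t) = - \<beta> t * d t" for t
  proof -
    have "\<beta> t * d t = a * (sin (fst (?v t)) - sin (fst (?u t)))"
      by (cases "d t = 0") (simp_all add: \<beta>_def, simp add: d_def)
    then show ?thesis
      by (simp add: algebra_simps)
  qed
  then have der_e: "(e has_real_derivative - \<beta> t * d t) (at t)" for t
    using DERIV_diff[OF rflow_components(2)[of "(q, p')" t] rflow_components(2)[of "(q, p)" t]]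
    by (simp add: e_def[abs_def])
  have \<alpha>: "0 < \<alpha> t \<and> \<alpha> t \<le> 1" for t
  proof (cases "e t" "0 :: real" rule: linorder_cases)
    case less
    then have "vel (snd (?v t)) < vel (snd (?u t))"
      by (intro vel_mono) (simp add: e_def)
    then show ?thesis
      using less vel_lipschitz[of "snd (?v t)" "snd (?u t)"]
      by (auto simp: \<alpha>_def e_def divide_simps)
  next
    case greater
    then have "vel (snd (?u t)) < vel (snd (?v t))"
      by (intro vel_mono) (simp add: e_def)
    then show ?thesis
      using greater vel_lipschitz[of "snd (?v t)" "snd (?u t)"]
      by (auto simp: \<alpha>_def e_def divide_simps)
  qed (simp add: \<alpha>_def)
  have \<beta>: "\<beta> t < a" for t
  proof (cases "d t = 0")
    case False
    then have "\<bar>sin (fst (?v t)) - sin (fst (?u t))\<bar> < \<bar>d t\<bar>"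
      unfolding d_def by (intro abs_sin_diff_less) auto
    then have "\<bar>(sin (fst (?v t)) - sin (fst (?u t))) / d t\<bar> < 1"
      using False by (simp add: abs_divide)
    then have "(sin (fst (?v t)) - sin (fst (?u t))) / d t < 1"
      by linarith
    then have "a * ((sin (fst (?v t)) - sin (fst (?u t))) / d t) < a * 1"
      using a_pos by (intro mult_strict_left_mono)
    then show ?thesis
      using False by (simp add: \<beta>_def)
  qed (use a_pos in \<open>simp add: \<beta>_def\<close>)
  have "\<beta> (T / 2) = (pi / T)\<^sup>2"
  proof (rule sturm_positive_or_rigid(2)[OF T_pos der_d der_e])
    show "d T \<le> 0"
      using neg by (simp add: d_def \<tau>_def P_eq)
    show "\<beta> t \<le> (pi / T)\<^sup>2" for t
      using \<beta>[of t] assms by linarith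
  qed (use \<alpha> T_pos \<open>p < p'\<close> in \<open>auto simp: d_def e_def rflow(1) less_imp_le\<close>)
  then show False
    using \<beta>[of "T / 2"] assms by simp
qed

text \<open>The derivative of \<open>\<tau>\<close> in direction \<open>p\<close> obeys the same comparison, but now \<open>\<beta> = a cos q\<close> may reach \<open>a\<close>. In the rigid
  case \<open>cos q = 1\<close> and \<open>p = 0\<close> on the whole period (except at \<open>T / 2\<close>, where continuity takes over): the solution
  rests at an equilibrium, and the momentum equation leaves no force.\<close>

lemma variation_positive_or_trivial:
  assumes "a \<le> (pi / T)\<^sup>2" and neg: "fst (rvflow z (0, 1) T) \<le> 0"
  shows "a = (pi / T)\<^sup>2" "f = (\<lambda>_. 0)" "fst (rflow z T) = fst z"
proof -
  define \<alpha> where "\<alpha> t = 1 / sqrt (1 + (snd (rflow z t))\<^sup>2) ^ 3" for t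
  define \<beta> where "\<beta> t = a * cos (fst (rflow z t))" for t
  have \<alpha>: "0 < \<alpha> t" "\<alpha> t \<le> 1" for t
  proof -
    show "0 < \<alpha> t"
      by (simp add: \<alpha>_def one_plus_square_pos)
    have "\<alpha> t \<le> 1 / 1"
      unfolding \<alpha>_def
      by (rule divide_left_mono[OF sqrt_one_plus_square_ge]) (simp_all add: one_plus_square_pos)
    then show "\<alpha> t \<le> 1"
      by simp
  qed
  have \<beta>: "\<beta> t \<le> a" for t
    using a_pos by (simp add: \<beta>_def)
  have rigid: "\<beta> t = (pi / T)\<^sup>2" "\<alpha> t = 1 \<or> cos (pi / T * t) = 0" if "0 < t" "t < T" for t
  proof -
    note hyps = T_pos rvflow_components(1)[of z "(0, 1)", folded \<alpha>_def]
      rvflow_components(2)[of z "(0, 1)", folded \<beta>_def] conjI[OF less_imp_le[OF \<alpha>(1)] \<alpha>(2)]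
      order_trans[OF \<beta> assms(1)]
    show "\<beta> t = (pi / T)\<^sup>2" "\<alpha> t = 1 \<or> cos (pi / T * t) = 0"
      by (rule sturm_positive_or_rigid[OF hyps _ _ \<alpha>(1) neg that]; simp add: rvflow(1))+
  qed
  show "a = (pi / T)\<^sup>2"
    using rigid(1)[of "T / 2"] \<beta>[of "T / 2"] assms T_pos by simp
  then have cos1: "cos (fst (rflow z t)) = 1" if "0 < t" "t < T" for t
    using rigid(1)[OF that] a_pos by (simp add: \<beta>_def)
  have p0: "snd (rflow z t) = 0" if t: "t \<in> {0<..<T/2} \<union> {T/2<..<T}" for t
  proof -
    have "cos (pi / T * t) \<noteq> cos (pi / 2)"
    proof
      assume eq: "cos (pi / T * t) = cos (pi / 2)"
      have "pi / T * t = pi / 2"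
        by (rule cos_inj_pi[OF _ _ _ _ eq]) (use t T_pos in \<open>auto simp: field_simps\<close>)
      then show False
        using t T_pos by (auto simp: field_simps)
    qed
    then have "\<alpha> t = 1"
      using rigid(2)[of t] t T_pos by auto
    then have "sqrt (1 + (snd (rflow z t))\<^sup>2) ^ 3 = 1 ^ 3"
      using one_plus_square_pos[of "snd (rflow z t)"] by (simp add: \<alpha>_def)
    then have "sqrt (1 + (snd (rflow z t))\<^sup>2) = 1"
      by (rule power_eq_imp_eq_base) auto
    then show ?thesis
      by simp
  qed
  have clos: "{0..T} \<subseteq> closure ({0<..<T/2} \<union> {T/2<..<T})"
    using T_pos by (auto simp: closure_Un closure_greaterThanLessThan)
  have "continuous_on UNIV (\<lambda>t. snd (rflow z t))"
    using rflow_components(2) by (meson DERIV_isCont continuous_at_imp_continuous_on)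
  then have p0': "snd (rflow z t) = 0" if "0 \<le> t" "t \<le> T" for t
    using continuous_constant_on_closure[of "{0<..<T/2} \<union> {T/2<..<T}" "\<lambda>t. snd (rflow z t)" 0 t]
      p0 clos that continuous_on_subset by (metis atLeastAtMost_iff subsetD subset_UNIV)
  have f0: "f t = 0" if t: "0 < t" "t < T" for t
  proof -
    have "((\<lambda>t. snd (rflow z t)) has_real_derivative 0) (at t)"
      by (rule has_field_derivative_transform_within_open[of "\<lambda>_. 0" _ _ "{0<..<T}"])
        (use t p0' in auto)
    from DERIV_unique[OF rflow_components(2) this] have "a * sin (fst (rflow z t)) = f t"
      by simp
    moreover have "sin (fst (rflow z t)) = 0"
      using cos1[OF t] sin_cos_squared_add[of "fst (rflow z t)"] by simp
    ultimately show ?thesis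
      by simp
  qed
  have f0': "f t = 0" if "0 \<le> t" "t \<le> T" for t
    using continuous_constant_on_closure[of "{0<..<T}" f 0 t] f0 that T_pos
      continuous_on_subset[OF f_cont] by (simp add: closure_greaterThanLessThan)
  show "f = (\<lambda>_. 0)"
  proof
    fix t
    obtain k :: int where k: "0 \<le> t - of_int k * T" "t - of_int k * T < T"
      using ex_int_shift_into_period[OF T_pos] by blast
    then show "f t = 0"
      using quasi_periodic_of_int[of f T 0 "t - of_int k * T" k] f_per f0' by simp
  qed
  have "fst (rflow z T) - fst (rflow z 0) = 0"
  proof -
    obtain t where "0 < t" "t < T" "fst (rflow z T) - fst (rflow z 0) = (T - 0) * vel (snd (rflow z t))"
      using MVT2[OF T_pos rflow_components(1)] by blast
    then show ?thesis
      using p0'[of t] by (simp add: vel_def)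
  qed
  then show "fst (rflow z T) = fst z"
    by (simp add: rflow(1))
qed

end

section \<open>Discrete or everything\<close>

text \<open>The last assumption excludes the unforced pendulum with \<open>a = (pi / T)\<^sup>2\<close>, for which the twist at the equilibrium
  \<open>(0, 0)\<close> has derivative zero when \<open>N = 0\<close>.\<close>

locale bounded_winding = forced_pendulum +
  assumes slow: "a \<le> (pi / T)\<^sup>2" and subluminal: "\<bar>2 * of_int N * pi\<bar> < T"
    and nontrivial: "a = (pi / T)\<^sup>2 \<Longrightarrow> f \<noteq> (\<lambda>t. a * sin (2 * of_int N * pi / T * t))"
begin

lemma \<tau>_less_iff: "\<tau> (q, p) < \<tau> (q, p') \<longleftrightarrow> p < p'"
  using twist[OF slow, of p p' q] twist[OF slow, of p' p q] by (cases p p' rule: linorder_cases) auto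

lemma ex_zero_displacement: "\<exists>p. \<tau> (q, p) = 0"
proof -
  obtain K where K: "\<And>q p. p \<ge> K \<Longrightarrow> \<tau> (q, p) > 0" "\<And>q p. p \<le> - K \<Longrightarrow> \<tau> (q, p) < 0"
    using far_displacement[OF subluminal] by blast
  have "\<exists>p\<ge>- \<bar>K\<bar>. p \<le> \<bar>K\<bar> \<and> \<tau> (q, p) = 0"
    using less_imp_le[OF K(1)[of "\<bar>K\<bar>" q]] less_imp_le[OF K(2)[of "- \<bar>K\<bar>" q]]
    by (intro IVT' continuous_on_compose2[OF continuous_\<tau>[of UNIV]])
      (auto intro!: continuous_intros)
  then show ?thesis
    by blast
qed

text \<open>The curve of initial states whose position returns with winding number \<open>N\<close>. All fixed points of the Poincare map lie
  on it.\<close>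

definition \<phi> :: "real \<Rightarrow> real" where
  "\<phi> q = (THE p. \<tau> (q, p) = 0)"

lemma \<tau>_eq_0_iff: "\<tau> (q, p) = 0 \<longleftrightarrow> p = \<phi> q"
proof -
  have "\<exists>!p. \<tau> (q, p) = 0"
    using ex_zero_displacement[of q] \<tau>_less_iff by (metis linorder_neqE_linordered_idom less_irrefl)
  from theI'[OF this, folded \<phi>_def] this show ?thesis
    by metis
qed

lemma \<tau>_\<phi>: "\<tau> (q, \<phi> q) = 0"
  by (simp add: \<tau>_eq_0_iff)

lemma \<phi>_shift: "\<phi> (q + 2 * pi * of_int k) = \<phi> q"
proof -
  have "\<tau> (q + 2 * pi * of_int k, \<phi> q) = \<tau> (q, \<phi> q)"
    by (simp add: \<tau>_def P_shift)
  then show ?thesis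
    using \<tau>_eq_0_iff \<tau>_\<phi> by metis
qed

text \<open>\<open>\<tau>\<close> has opposite signs slightly below and slightly above the curve at \<open>s\<close>; the signs persist nearby, and
  monotonicity in \<open>p\<close> traps \<open>\<phi>\<close>.\<close>

lemma isCont_\<phi>: "isCont \<phi> s"
  unfolding isCont_def
proof (rule tendstoI)
  fix \<epsilon> :: real assume "\<epsilon> > 0"
  have lim: "((\<lambda>x. \<tau> (x, p)) \<longlongrightarrow> \<tau> (s, p)) (at s)" for p
  proof -
    have "continuous_on UNIV (\<lambda>x. \<tau> (x, p))"
      by (intro continuous_on_compose2[OF continuous_\<tau>[of UNIV]] continuous_intros) auto
    then show ?thesis
      by (simp add: continuous_on_def)
  qed
  have "\<tau> (s, \<phi> s - \<epsilon>) < 0" "0 < \<tau> (s, \<phi> s + \<epsilon>)"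
    using \<tau>_less_iff[of s "\<phi> s - \<epsilon>" "\<phi> s"] \<tau>_less_iff[of s "\<phi> s" "\<phi> s + \<epsilon>"] \<tau>_\<phi>[of s] \<open>\<epsilon> > 0\<close>
    by auto
  then have "\<forall>\<^sub>F x in at s. \<tau> (x, \<phi> s - \<epsilon>) < 0" "\<forall>\<^sub>F x in at s. 0 < \<tau> (x, \<phi> s + \<epsilon>)"
    using order_tendstoD[OF lim] by blast+
  then show "\<forall>\<^sub>F x in at s. dist (\<phi> x) (\<phi> s) < \<epsilon>"
  proof eventually_elim
    case (elim x)
    then show ?case
      using \<tau>_less_iff[of x "\<phi> s - \<epsilon>" "\<phi> x"] \<tau>_less_iff[of x "\<phi> x" "\<phi> s + \<epsilon>"] \<tau>_\<phi>[of x]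
      by (auto simp: dist_real_def abs_less_iff)
  qed
qed

lemma continuous_\<phi>: "continuous_on A \<phi>"
  using isCont_\<phi> by (simp add: continuous_at_imp_continuous_on)

definition fixed_positions :: "real set" where
  "fixed_positions = {s. P (s, \<phi> s) = (s, \<phi> s)}"

lemma fixed_point_iff: "P (q, p) = (q, p) \<longleftrightarrow> q \<in> fixed_positions \<and> p = \<phi> q"
  using \<tau>_eq_0_iff[of q p] by (auto simp: fixed_positions_def \<tau>_def)

lemma fixed_positions_iff: "s \<in> fixed_positions \<longleftrightarrow> snd (P (s, \<phi> s)) = \<phi> s"
  using \<tau>_\<phi>[of s] by (auto simp: fixed_positions_def \<tau>_def prod_eq_iff)

lemma fixed_positions_shift: "s + 2 * pi * of_int k \<in> fixed_positions \<longleftrightarrow> s \<in> fixed_positions"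
  by (simp add: fixed_positions_def \<phi>_shift P_shift prod_eq_iff)

lemma closed_fixed_positions: "closed fixed_positions"
proof -
  have "continuous_on UNIV (\<lambda>s. P (s, \<phi> s))"
    by (intro continuous_on_compose2[OF continuous_P[of UNIV]] continuous_intros continuous_\<phi>) auto
  then show ?thesis
    unfolding fixed_positions_def by (intro closed_Collect_eq continuous_intros continuous_\<phi>)
qed

lemma variation_positive: "fst (rvflow (s, \<phi> s) (0, 1) T) > 0"
proof (rule ccontr)
  assume "\<not> ?thesis"
  then have triv: "a = (pi / T)\<^sup>2" "f = (\<lambda>_. 0)" "fst (rflow (s, \<phi> s) T) = s"
    using variation_positive_or_trivial[OF slow, of "(s, \<phi> s)"] by auto
  have "2 * of_int N * pi = 0"
    using \<tau>_\<phi>[of s] triv(3) unfolding \<tau>_def P_eq fst_conv by linarith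
  then have "N = 0"
    by simp
  then show False
    using nontrivial triv by simp
qed

text \<open>The curve is the zero set of \<open>\<tau>\<close>, the first function; the second function is the defect of momentum over a period.\<close>

lemma fixed_positions_locally_full:
  assumes "s islimpt fixed_positions"
  shows "\<forall>\<^sub>F x in nhds s. x \<in> fixed_positions"
proof -
  let ?w = "complex_of_real (2 * of_int N * pi)"
  let ?G = "\<lambda>z. fst (cflow z T) - (1 * fst z + 0 * snd z + ?w)"
  let ?H = "\<lambda>z. snd (cflow z T) - (0 * fst z + 1 * snd z + 0)"
  have G: "?G (of_real x, of_real p) = of_real (\<tau> (x, p))" for x p
    using cflow_emb[of "(x, p)" T] by (simp add: emb_def \<tau>_def P_eq)
  have H: "?H (of_real x, of_real (\<phi> x)) = 0 \<longleftrightarrow> x \<in> fixed_positions" for x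
    using cflow_emb[of "(x, \<phi> x)" T] by (simp add: emb_def fixed_positions_iff P_eq)
  have "\<forall>\<^sub>F x in nhds s. ?H (of_real x, of_real (\<phi> x)) = 0"
  proof (rule holomorphic_zero_set_locally_full[OF
        strictly_differentiable_on_diff[OF strictly_differentiable_cflow(1)]
        strictly_differentiable_on_diff[OF strictly_differentiable_cflow(2)]
        open_tube _ _ isCont_\<phi>])
    show "(of_real s, of_real (\<phi> s)) \<in> tube"
      using emb_in_tube[of "(s, \<phi> s)"] by (simp add: emb_def)
    have "cvflow (emb (s, \<phi> s)) (emb (0, 1)) T = emb (rvflow (s, \<phi> s) (0, 1) T)"
      by (rule cvflow_emb)
    then show "fst (cvflow (of_real s, of_real (\<phi> s)) (0, 1) T) - 0 \<noteq> 0"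
      using variation_positive[of s] by (simp add: emb_def)
    show "?G (of_real x, of_real (\<phi> x)) = 0" for x
      unfolding G \<tau>_\<phi> by simp
    show "s islimpt {x. ?H (of_real x, of_real (\<phi> x)) = 0}"
      unfolding H using assms by simp
  qed
  then show ?thesis
    unfolding H .
qed

text \<open>The limit points form a set that is closed and, by \<open>fixed_positions_locally_full\<close>, open.\<close>

lemma discrete_or_everything: "(\<forall>s. \<not> s islimpt fixed_positions) \<or> fixed_positions = UNIV"
proof -
  let ?D = "{s. s islimpt fixed_positions}"
  have "open ?D"
    unfolding open_subopen[of ?D]
  proof
    fix s assume "s \<in> ?D"
    then have "\<forall>\<^sub>F x in nhds s. x \<in> fixed_positions"
      using fixed_positions_locally_full by simp
    then obtain U where U: "open U" "s \<in> U" "\<And>x. x \<in> U \<Longrightarrow> x \<in> fixed_positions"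
      unfolding eventually_nhds by blast
    have "x islimpt fixed_positions" if "x \<in> U" for x
    proof (rule islimpt_subset)
      show "x islimpt U"
        using interior_limit_point[of x U] \<open>open U\<close> that by (simp add: interior_open)
    qed (use U in blast)
    then show "\<exists>T. open T \<and> s \<in> T \<and> T \<subseteq> ?D"
      using U by blast
  qed
  moreover have "closed ?D"
    by (rule closed_limpts)
  ultimately have "?D = {} \<or> ?D = UNIV"
    using clopen[of ?D] by simp
  then show ?thesis
    using closed_fixed_positions closed_limpt[of fixed_positions] by blast
qed

text \<open>Every shift class contains a solution with initial position in \<open>{0..2 * pi}\<close>, and such a solution is determined by this
  position; a discrete closed set meets this interval in finitely many points.\<close>

lemma finitely_many_isolated_if_discrete:
  assumes disc: "\<And>s. \<not> s islimpt fixed_positions"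
  shows "finitely_many_isolated a f T N"
  unfolding finitely_many_isolated_def
proof (intro conjI allI impI)
  have per: "system_solution a f x (momentum x)" "periodic_system_solution a f T N x (momentum x)"
      "x 0 \<in> fixed_positions" "momentum x 0 = \<phi> (x 0)"
    if "periodic_solution a f T N x" for x
  proof -
    show sol: "system_solution a f x (momentum x)"
      using that by (simp add: periodic_solution_def system_solution_iff)
    have "momentum x (t + T) = momentum x t" for t
    proof -
      have shift: "x (t + T) = x t + 2 * of_int N * pi" for t
        using that by (simp add: periodic_solution_def)
      have dx: "(x has_real_derivative deriv x t) (at t)" for t
        using that by (simp add: periodic_solution_def pendulum_solution_def DERIV_deriv_iff_real_differentiable)
      have "((\<lambda>t. x (t + T)) has_real_derivative deriv x (t + T)) (at t)"
        using dx[of "t + T"] by (simp add: DERIV_shift)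
      then have "((\<lambda>t. x t + 2 * of_int N * pi) has_real_derivative deriv x (t + T)) (at t)"
        by (simp add: shift)
      moreover have "((\<lambda>t. x t + 2 * of_int N * pi) has_real_derivative deriv x t + 0) (at t)"
        by (intro DERIV_add dx DERIV_const)
      ultimately have "deriv x (t + T) = deriv x t"
        using DERIV_unique by fastforce
      then show ?thesis
        by (simp add: momentum_def)
    qed
    then show psol: "periodic_system_solution a f T N x (momentum x)"
      using that sol by (simp add: periodic_system_solution_def periodic_solution_def)
    then have "P (x 0, momentum x 0) = (x 0, momentum x 0)"
      using periodic_iff_fixed[OF sol] by blast
    then show "x 0 \<in> fixed_positions" "momentum x 0 = \<phi> (x 0)"
      by (simp_all add: fixed_point_iff)
  qed
  show "isolated_periodic_solution a f T N x" if x: "periodic_solution a f T N x" for x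
  proof -
    obtain \<delta> where \<delta>: "\<delta> > 0" "\<And>s. s \<in> fixed_positions \<Longrightarrow> s \<noteq> x 0 \<Longrightarrow> dist s (x 0) \<ge> \<delta>"
      using disc[of "x 0"] by (auto simp: islimpt_approachable not_less)
    have "\<not> periodic_system_solution a f T N q p"
      if qp: "system_solution a f q p" "0 < \<bar>q 0 - x 0\<bar> + \<bar>p 0 - momentum x 0\<bar>"
        "\<bar>q 0 - x 0\<bar> + \<bar>p 0 - momentum x 0\<bar> < \<delta>" for q p
    proof
      assume "periodic_system_solution a f T N q p"
      then have "q 0 \<in> fixed_positions" "p 0 = \<phi> (q 0)"
        using periodic_iff_fixed[OF qp(1)] fixed_point_iff by blast+
      moreover have "dist (q 0) (x 0) < \<delta>"
        using qp(3) by (simp add: dist_real_def)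
      ultimately show False
        using \<delta>(2)[of "q 0"] per(4)[OF x] qp(2) by (cases "q 0 = x 0") auto
    qed
    then have "isolated_system_solution a f T N x (momentum x)"
      unfolding isolated_system_solution_def using per(2)[OF x] \<delta>(1) by blast
    then show ?thesis
      using x by (simp add: isolated_periodic_solution_def)
  qed
  define y where "y s t = fst (rflow (s, \<phi> s) t)" for s t
  have "{x. isolated_periodic_solution a f T N x} // shift_rel
      \<subseteq> (\<lambda>s. shift_rel `` {y s}) ` ({0..2 * pi} \<inter> fixed_positions)"
  proof
    fix X assume "X \<in> {x. isolated_periodic_solution a f T N x} // shift_rel"
    then obtain x where x: "periodic_solution a f T N x" and X: "X = shift_rel `` {x}"
      by (auto simp: quotient_def isolated_periodic_solution_def)
    obtain k :: int where k: "0 \<le> x 0 - of_int k * (2 * pi)" "x 0 - of_int k * (2 * pi) < 2 * pi"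
      using ex_int_shift_into_period[of "2 * pi" "x 0"] by auto
    define s where "s = x 0 - of_int k * (2 * pi)"
    have x0: "x 0 = s + 2 * pi * of_int k"
      by (simp add: s_def)
    have "s \<in> fixed_positions"
      using per(3)[OF x] unfolding x0 fixed_positions_shift .
    have "(x t, momentum x t) = rflow (s + 2 * pi * of_int k, \<phi> s) t" for t
      using system_solution_iff_rflow[THEN iffD1, rule_format, OF per(1)[OF x], of t]
      unfolding per(4)[OF x] x0 \<phi>_shift .
    then have "x t = y s t + 2 * pi * of_int k" for t
      unfolding rflow_shift y_def by (metis fst_add fst_conv)
    then have xy: "x = (\<lambda>t. y s t + 2 * of_int k * pi)"
      by (simp add: fun_eq_iff mult_ac)
    have "shift_rel `` {x} = shift_rel `` {y s}"
    proof (intro set_eqI iffI)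
      fix z assume "z \<in> shift_rel `` {x}"
      then obtain l :: int where "\<forall>t. z t = x t + 2 * of_int l * pi"
        by (auto simp: shift_rel_def)
      then have "\<forall>t. z t = y s t + 2 * of_int (l + k) * pi"
        by (simp add: xy algebra_simps)
      then show "z \<in> shift_rel `` {y s}"
        unfolding shift_rel_def by blast
    next
      fix z assume "z \<in> shift_rel `` {y s}"
      then obtain l :: int where "\<forall>t. z t = y s t + 2 * of_int l * pi"
        by (auto simp: shift_rel_def)
      then have "\<forall>t. z t = x t + 2 * of_int (l - k) * pi"
        by (simp add: xy algebra_simps)
      then show "z \<in> shift_rel `` {x}"
        unfolding shift_rel_def by blast
    qed
    then show "X \<in> (\<lambda>s. shift_rel `` {y s}) ` ({0..2 * pi} \<inter> fixed_positions)"
      using X \<open>s \<in> fixed_positions\<close> k by (auto simp: s_def)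
  qed
  moreover have "finite ({0..2 * pi} \<inter> fixed_positions)"
    by (rule finite_not_islimpt_in_compact) (use disc in auto)
  ultimately show "finite ({x. isolated_periodic_solution a f T N x} // shift_rel)"
    by (rule finite_surj[rotated])
qed

lemma degenerate_case_if_everything:
  assumes "fixed_positions = UNIV"
  shows "degenerate_case a f T N"
proof -
  define q where "q s t = fst (rflow (s, \<phi> s) t)" for s t
  define p where "p s t = snd (rflow (s, \<phi> s) t)" for s t
  have init: "q s 0 = s" "p s 0 = \<phi> s" for s
    by (simp_all add: q_def p_def rflow(1))
  have sol: "system_solution a f (q s) (p s)" for s
    using system_solution_of_rflow[of "(s, \<phi> s)"] by (simp add: q_def[abs_def] p_def[abs_def])
  have "P (s, \<phi> s) = (s, \<phi> s)" for s
    using assms by (simp add: fixed_point_iff)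
  then have "periodic_system_solution a f T N (q s) (p s)" for s
    unfolding periodic_iff_fixed[OF sol] init .
  moreover have "q (s + 2 * pi) t = q s t + 2 * pi" "p (s + 2 * pi) t = p s t" for s t
    using rflow_shift[of s 1 "\<phi> s" t] \<phi>_shift[of s 1] by (simp_all add: q_def p_def)
  ultimately have "degenerate_family a f T N q p"
    unfolding degenerate_family_def init using sol
    by (auto intro!: continuous_intros continuous_\<phi> simp: bij_betw_def)
  then show ?thesis
    unfolding degenerate_case_def by blast
qed

text \<open>A degenerate family is required to be periodic only for parameters in \<open>{0..<2 * pi}\<close>; the other parameters are
  reached by shifts.\<close>

lemma degenerate_solution_periodic:
  assumes "degenerate_solution a f T N q p"
  shows "P (q 0, p 0) = (q 0, p 0)"
proof -
  obtain Q R s where fam: "degenerate_family a f T N Q R" and q: "q = Q s" "p = R s"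
    using assms unfolding degenerate_solution_def by blast
  have sol: "system_solution a f (Q s) (R s)"
    and shift: "Q (s + 2 * pi) t = Q s t + 2 * pi" "R (s + 2 * pi) t = R s t" 
    and per: "s \<in> {0..<2 * pi} \<Longrightarrow> periodic_system_solution a f T N (Q s) (R s)" for s t
    using fam unfolding degenerate_family_def by blast+
  obtain k :: int where k: "0 \<le> s - of_int k * (2 * pi)" "s - of_int k * (2 * pi) < 2 * pi"
    using ex_int_shift_into_period[of "2 * pi" s] by auto
  define r where "r = s - of_int k * (2 * pi)"
  have "P (Q r 0, R r 0) = (Q r 0, R r 0)"
    using per[of r] k periodic_iff_fixed[OF sol] by (simp add: r_def)
  moreover have "Q s 0 = Q r 0 + 2 * pi * of_int k" "R s 0 = R r 0"
    using quasi_periodic_of_int[of "\<lambda>s. Q s 0" "2 * pi" "2 * pi" r k]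
      quasi_periodic_of_int[of "\<lambda>s. R s 0" "2 * pi" 0 r k] shift by (simp_all add: r_def mult_ac)
  ultimately show ?thesis
    unfolding q by (simp add: P_shift)
qed

lemma unstable_if_everything:
  assumes "fixed_positions = UNIV" and "degenerate_solution a f T N q p"
  shows "unstable_solution a f T N q p"
proof -
  obtain K where K: "\<And>q p. p \<ge> K \<Longrightarrow> \<tau> (P (q, p)) > 0"
    using far_displacement[OF subluminal] by blast
  have fixed: "P z = z" if "\<tau> z = 0" for z
    using that assms(1) fixed_point_iff[of "fst z" "snd z"] \<tau>_eq_0_iff[of "fst z" "snd z"] by simp
  have "\<tau> (q 0, p 0) = 0"
    using degenerate_solution_periodic[OF assms(2)] by (simp add: \<tau>_def)
  then have "\<not> stable_point P (q 0, p 0)"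
    using unstable_curve_of_fixed_points[OF inj_P P_has_derivative rvflow_det,
        of K "(q 0, p 0)", folded \<tau>_def] twist[OF slow] K fixed by blast
  then show ?thesis
    by (simp add: unstable_solution_def)
qed

end

theorem theorem3:
  fixes T a :: real and N :: int and f :: "real \<Rightarrow> real"
  assumes "T > 0" and "a > 0"
    and "continuous_on UNIV f"
    and "\<And>t. f (t + T) = f t"
    and "integral {0..T} f = 0"
    and "a < pi\<^sup>2 / T\<^sup>2 \<or>
         a = pi\<^sup>2 / T\<^sup>2 \<and> f \<noteq> (\<lambda>t. a * sin (2 * of_int N * pi / T * t))"
  shows "finitely_many_isolated a f T N \<or>
         degenerate_case a f T N \<and>
         (\<forall>q p. degenerate_solution a f T N q p \<longrightarrow> unstable_solution a f T N q p)"
proof -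
  interpret forced_pendulum a T N f
    using assms by unfold_locales
  show ?thesis
  proof (cases "\<bar>2 * of_int N * pi\<bar> < T")
    case True
    interpret bounded_winding a T N f
      using assms(6) True by unfold_locales (auto simp: power_divide)
    show ?thesis
      using discrete_or_everything finitely_many_isolated_if_discrete
        degenerate_case_if_everything unstable_if_everything by blast
  next
    case False
    have "\<not> periodic_solution a f T N x" for x
    proof
      assume x: "periodic_solution a f T N x"
      then have sol: "system_solution a f x (momentum x)"
        by (simp add: periodic_solution_def system_solution_iff)
      have "x (0 + T) = x 0 + 2 * of_int N * pi"
        using x unfolding periodic_solution_def by blast
      moreover have "rflow (x 0, momentum x 0) T = (x T, momentum x T)"
        using system_solution_iff_rflow[THEN iffD1, rule_format, OF sol, of T] by (rule sym)
      ultimately have "\<tau> (x 0, momentum x 0) = 0"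
        by (simp add: \<tau>_def P_eq)
      then show False
        using no_fixed_point_if_too_fast False by simp
    qed
    then show ?thesis
      by (simp add: finitely_many_isolated_def isolated_periodic_solution_def)
  qed
qed

end
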